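(* Let $\Omega\subset\mathbb{R}^n$, $n\ge2$, be a bounded connected open set, let $u\in H^1_0(\Omega)\cap C^2(\Omega)$, and let $(K_\varepsilon)_{\varepsilon>0}$ be a family of compact sets contained in $\Omega$ concentrating to a point $x_0\in\Omega$ such that $u(x_0)\ne0$. Then $$\mathrm{Cap}_\Omega(K_\varepsilon,u)=u^2(x_0)\,\mathrm{Cap}_\Omega(K_\varepsilon)+o\big(\mathrm{Cap}_\Omega(K_\varepsilon)\big)\quad\text{as }\varepsilon\to0^+.$$
   Context: For a compact set $K\subset\Omega$ and $u\in H^1_0(\Omega)$, the $u$-capacity of $K$ in $\Omega$ is $$\mathrm{Cap}_\Omega(K,u)=\inf\Big\{\int_\Omega|\nabla f|^2\,dx:\ f\in H^1_0(\Omega),\ f-u\in H^1_0(\Omega\setminus K)\Big\}.$$ The condenser capacity is $\mathrm{Cap}_\Omega(K)=\mathrm{Cap}_\Omega(K,\eta_K)$, where $\eta_K$ is any fixed smooth function with support in $\Omega$ and $\eta_K\equiv1$ in a neighborhood of $K$. A family $\{K_\varepsilon\}_{\varepsilon>0}$ of compact subsets of $\Omega$ is concentrating to a compact set $K\subset\Omega$ if for every open $U\subseteq\Omega$ with $U\supset K$ there exists $\varepsilon_U>0$ such that $K_\varepsilon\subset U$ for every $\varepsilon<\varepsilon_U$; concentrating to a point $x_0$ means concentrating to $\{x_0\}$. *)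

theory Defs
  imports "HOL-Analysis.Analysis" "HOL-Library.Landau_Symbols"
begin

primrec Ck_on :: "nat \<Rightarrow> 'a::euclidean_space set \<Rightarrow> ('a \<Rightarrow> real) \<Rightarrow> bool" where
  "Ck_on 0 S f \<longleftrightarrow> continuous_on S f"
| "Ck_on (Suc k) S f \<longleftrightarrow>
     (\<exists>D. (\<forall>x\<in>S. GDERIV f x :> D x) \<and> (\<forall>b\<in>Basis. Ck_on k S (\<lambda>x. D x \<bullet> b)))"

definition grad :: "('a::euclidean_space \<Rightarrow> real) \<Rightarrow> 'a \<Rightarrow> 'a" where
  "grad f x = (THE D. GDERIV f x :> D)"

text \<open>The space $C_c^\infty(U)$, its elements being regarded as functions on the whole space.\<close>

definition test_functions :: "'a::euclidean_space set \<Rightarrow> ('a \<Rightarrow> real) set" where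
  "test_functions U =
     {\<phi>. (\<forall>k. Ck_on k UNIV \<phi>) \<and> compact (closure {x. \<phi> x \<noteq> 0}) \<and> closure {x. \<phi> x \<noteq> 0} \<subseteq> U}"

definition L2_on :: "'a::euclidean_space set \<Rightarrow> ('a \<Rightarrow> 'b::euclidean_space) \<Rightarrow> bool" where
  "L2_on U f \<longleftrightarrow> f \<in> borel_measurable (lebesgue_on U) \<and> integrable (lebesgue_on U) (\<lambda>x. (norm (f x))\<^sup>2)"

text \<open>\<open>H1_grad U f g\<close>: the function \<open>f\<close> lies in $H^1(U)$ and \<open>g\<close> is (a representative of) its
  weak gradient on the open set \<open>U\<close>.\<close>

definition H1_grad :: "'a::euclidean_space set \<Rightarrow> ('a \<Rightarrow> real) \<Rightarrow> ('a \<Rightarrow> 'a) \<Rightarrow> bool" where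
  "H1_grad U f g \<longleftrightarrow> L2_on U f \<and> L2_on U g \<and>
     (\<forall>\<phi>\<in>test_functions U. \<forall>b\<in>Basis.
        (LINT x|lebesgue_on U. f x * (grad \<phi> x \<bullet> b)) = - (LINT x|lebesgue_on U. (g x \<bullet> b) * \<phi> x))"

text \<open>$H^1_0(U)$ is the closure of $C_c^\infty(U)$ in the $H^1$ norm. Its elements are regarded as
  functions on the whole space, extended by zero: the norms are taken over the whole space, so that
  membership forces \<open>f = 0\<close> almost everywhere outside \<open>U\<close>. In particular,
  \<open>(\<lambda>x. f x - u x) \<in> H10 (\<Omega> - K)\<close> forces \<open>f = u\<close> almost everywhere on \<open>K\<close>; taking the norms over
  \<open>\<Omega> - K\<close> only would leave \<open>f\<close> unconstrained in the interior of \<open>K\<close>.\<close>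

definition H10 :: "'a::euclidean_space set \<Rightarrow> ('a \<Rightarrow> real) set" where
  "H10 U = {f. \<exists>g. H1_grad UNIV f g \<and>
     (\<exists>\<phi>. (\<forall>k::nat. \<phi> k \<in> test_functions U) \<and>
       (\<lambda>k. LINT x|lebesgue. (\<phi> k x - f x)\<^sup>2) \<longlonglongrightarrow> 0 \<and>
       (\<lambda>k. LINT x|lebesgue. (norm (grad (\<phi> k) x - g x))\<^sup>2) \<longlonglongrightarrow> 0)}"

definition u_capacity :: "'a::euclidean_space set \<Rightarrow> 'a set \<Rightarrow> ('a \<Rightarrow> real) \<Rightarrow> real" where
  "u_capacity \<Omega> K u =
     Inf {(LINT x|lebesgue_on \<Omega>. (norm (g x))\<^sup>2) | f g.
            f \<in> H10 \<Omega> \<and> H1_grad \<Omega> f g \<and> (\<lambda>x. f x - u x) \<in> H10 (\<Omega> - K)}"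

text \<open>Since $\Omega$ will be bounded, a closed support contained in $\Omega$ is automatically
  compact.\<close>

definition cutoff :: "'a::euclidean_space set \<Rightarrow> 'a set \<Rightarrow> ('a \<Rightarrow> real) \<Rightarrow> bool" where
  "cutoff \<Omega> K \<eta> \<longleftrightarrow> \<eta> \<in> test_functions \<Omega> \<and> (\<exists>V. open V \<and> K \<subseteq> V \<and> (\<forall>x\<in>V. \<eta> x = 1))"

text \<open>The choice of the cutoff is immaterial: two cutoffs differ by a test function on
  \<open>\<Omega> - K\<close>.\<close>

definition condenser_capacity :: "'a::euclidean_space set \<Rightarrow> 'a set \<Rightarrow> real" where
  "condenser_capacity \<Omega> K = u_capacity \<Omega> K (SOME \<eta>. cutoff \<Omega> K \<eta>)"

definition concentrating_to ::
    "'a::euclidean_space set \<Rightarrow> (real \<Rightarrow> 'a set) \<Rightarrow> 'a set \<Rightarrow> bool" where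
  "concentrating_to \<Omega> K K0 \<longleftrightarrow>
     (\<forall>U. open U \<and> U \<subseteq> \<Omega> \<and> K0 \<subseteq> U \<longrightarrow> (\<exists>\<epsilon>U>0. \<forall>\<epsilon>. 0 < \<epsilon> \<and> \<epsilon> < \<epsilon>U \<longrightarrow> K \<epsilon> \<subseteq> U))"

end

theory Submission
  imports Defs
begin

text \<open>
  \<open>u \<mapsto> sqrt (u_capacity \<Omega> K u)\<close> is the quotient seminorm of the Dirichlet norm by
  \<open>H10 (\<Omega> - K)\<close>, so it suffices to bound the capacity of \<open>u - u x0 * \<eta>\<close>, for a cutoff \<open>\<eta>\<close>, by a
  small multiple of the capacity of \<open>\<eta>\<close>. Let \<open>K\<close> lie in the ball of radius \<open>r\<close> about \<open>x0\<close>, let \<open>\<zeta>\<close>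
  be a bump function at scale \<open>r\<close>, and let the test function \<open>\<phi>\<close> be almost optimal for \<open>\<eta>\<close>. Then
  \<open>\<phi> \<zeta> (u - u x0)\<close> is a competitor for \<open>u - u x0 * \<eta>\<close>. Since \<open>u\<close> is \<open>C\<^sup>1\<close>, the factor
  \<open>\<zeta> (u - u x0)\<close> is \<open>O(r)\<close> with bounded gradient, so the energy of the competitor is at most
  \<open>O(r\<^sup>2)\<close> times that of \<open>\<phi>\<close> plus \<open>O(1)\<close> times the integral of \<open>\<phi>\<^sup>2\<close> over the ball of radius \<open>2 r\<close>.
  The latter is \<open>O(r)\<close> times the energy of \<open>\<phi>\<close>, because the ball lies in a slab of width \<open>4 r\<close>.
\<close>

subsection \<open>Functions of class \<open>C\<^sup>k\<close>\<close>

lemma GDERIV_unique: "GDERIV f x :> D \<Longrightarrow> GDERIV f x :> D' \<Longrightarrow> D = D'"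
  unfolding gderiv_def by (metis has_derivative_unique inner_commute vector_eq_ldot)

lemma grad_eqI: "GDERIV f x :> D \<Longrightarrow> grad f x = D"
  unfolding grad_def using GDERIV_unique by blast

lemma GDERIV_isCont: "GDERIV f x :> D \<Longrightarrow> isCont f x"
  unfolding gderiv_def by (rule has_derivative_continuous)

lemma Ck_on_SucD: "Ck_on (Suc k) S f \<Longrightarrow> Ck_on k S f"
proof (induction k arbitrary: f)
  case 0
  then show ?case
    by (auto intro!: continuous_at_imp_continuous_on dest: GDERIV_isCont)
next
  case (Suc k)
  then obtain D where "\<forall>x\<in>S. GDERIV f x :> D x" "\<forall>b\<in>Basis. Ck_on (Suc k) S (\<lambda>x. D x \<bullet> b)"
    by auto
  with Suc.IH show ?case by auto
qed

lemma Ck_on_const: "Ck_on k S (\<lambda>x. c)"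
  by (induction k arbitrary: c) (auto intro!: exI[of _ "\<lambda>x. 0"] GDERIV_const)

lemma Ck_on_add: "Ck_on k S f \<Longrightarrow> Ck_on k S g \<Longrightarrow> Ck_on k S (\<lambda>x. f x + g x)"
proof (induction k arbitrary: f g)
  case 0
  then show ?case by (auto intro: continuous_intros)
next
  case (Suc k)
  then obtain D E where "\<forall>x\<in>S. GDERIV f x :> D x" "\<forall>b\<in>Basis. Ck_on k S (\<lambda>x. D x \<bullet> b)"
    "\<forall>x\<in>S. GDERIV g x :> E x" "\<forall>b\<in>Basis. Ck_on k S (\<lambda>x. E x \<bullet> b)"
    by auto
  with Suc.IH show ?case
    by (auto simp: inner_add_left intro!: exI[of _ "\<lambda>x. D x + E x"] GDERIV_add)
qed

lemma Ck_on_mult: "Ck_on k S f \<Longrightarrow> Ck_on k S g \<Longrightarrow> Ck_on k S (\<lambda>x. f x * g x)"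
proof (induction k arbitrary: f g)
  case 0
  then show ?case by (auto intro: continuous_intros)
next
  case (Suc k)
  \<comment> \<open>The product rule leaves \<open>f\<close> and \<open>g\<close> undifferentiated
    next to the gradients, so the induction hypothesis needs both at order \<open>k\<close>.\<close>
  note fg = Ck_on_SucD[OF Suc.prems(1)] Ck_on_SucD[OF Suc.prems(2)]
  from Suc.prems obtain D E where "\<forall>x\<in>S. GDERIV f x :> D x" "\<forall>b\<in>Basis. Ck_on k S (\<lambda>x. D x \<bullet> b)"
    "\<forall>x\<in>S. GDERIV g x :> E x" "\<forall>b\<in>Basis. Ck_on k S (\<lambda>x. E x \<bullet> b)"
    by auto
  with Suc.IH fg show ?case
    by (auto simp: inner_add_left intro!: exI[of _ "\<lambda>x. f x *\<^sub>R E x + g x *\<^sub>R D x"] GDERIV_mult Ck_on_add)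
qed

lemma Ck_on_inverse:
  "Ck_on k S f \<Longrightarrow> (\<And>x. x \<in> S \<Longrightarrow> f x \<noteq> 0) \<Longrightarrow> Ck_on k S (\<lambda>x. inverse (f x))"
proof (induction k)
  case 0
  then show ?case by (auto intro: continuous_intros)
next
  case (Suc k)
  note f = Suc.IH[OF Ck_on_SucD[OF Suc.prems(1)] Suc.prems(2)]
  from Suc.prems obtain D where D: "\<forall>x\<in>S. GDERIV f x :> D x" "\<forall>b\<in>Basis. Ck_on k S (\<lambda>x. D x \<bullet> b)"
    by auto
  have "Ck_on k S (\<lambda>x. (- 1) * ((inverse (f x) * inverse (f x)) * (D x \<bullet> b)))" if "b \<in> Basis" for b
    using D that f by (intro Ck_on_mult Ck_on_const) auto
  with D Suc.prems show ?case
    by (auto simp: power2_eq_square mult.assoc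
        intro!: exI[of _ "\<lambda>x. - (inverse (f x))\<^sup>2 *\<^sub>R D x"] GDERIV_inverse)
qed

lemma Ck_on_compose_real:
  fixes h :: "real \<Rightarrow> real"
  shows "Ck_on k UNIV h \<Longrightarrow> Ck_on k S f \<Longrightarrow> Ck_on k S (\<lambda>x. h (f x))"
proof (induction k arbitrary: h)
  case 0
  then show ?case by (auto intro: continuous_on_compose2)
next
  case (Suc k)
  from Suc.prems obtain D E where D: "\<forall>x\<in>S. GDERIV f x :> D x" "\<forall>b\<in>Basis. Ck_on k S (\<lambda>x. D x \<bullet> b)"
    and E: "\<forall>x. DERIV h x :> E x" "Ck_on k UNIV E"
    by auto
  have "Ck_on k S (\<lambda>x. E (f x))"
    using Suc.IH[OF E(2) Ck_on_SucD[OF Suc.prems(2)]] .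
  with D E show ?case
    by (auto intro!: exI[of _ "\<lambda>x. E (f x) *\<^sub>R D x"] GDERIV_DERIV_compose[of f _ _ h] Ck_on_mult)
qed

lemma GDERIV_inner_left: "GDERIV (\<lambda>x. x \<bullet> b) x :> b"
  unfolding gderiv_def by (auto intro!: derivative_eq_intros)

lemma Ck_on_inner_left: "Ck_on k S (\<lambda>x. x \<bullet> b)"
  by (cases k) (auto intro!: continuous_intros exI[of _ "\<lambda>x. b"] GDERIV_inner_left Ck_on_const)

lemma GDERIV_norm_diff_power2: "GDERIV (\<lambda>x. (norm (x - c))\<^sup>2) x :> 2 *\<^sub>R (x - c)"
  unfolding gderiv_def power2_norm_eq_inner
  by (auto intro!: derivative_eq_intros simp: inner_commute)

lemma Ck_on_norm_diff_power2: "Ck_on k S (\<lambda>x. (norm (x - c))\<^sup>2)"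
proof (cases k)
  case 0
  then show ?thesis by (auto intro!: continuous_intros)
next
  case (Suc m)
  have "Ck_on m S (\<lambda>x. 2 * ((x \<bullet> b) + (-(c \<bullet> b))))" for b
    by (intro Ck_on_mult Ck_on_add Ck_on_const Ck_on_inner_left)
  then show ?thesis
    unfolding Suc
    by (auto simp: inner_diff_left intro!: exI[of _ "\<lambda>x. 2 *\<^sub>R (x - c)"] GDERIV_norm_diff_power2)
qed

section \<open>A smooth step function on the line\<close>

lemma poly_times_exp_minus_tendsto_0:
  fixes p :: "real poly"
  shows "((\<lambda>s. poly p s * exp (- s)) \<longlongrightarrow> 0) at_top"
proof -
  have "((\<lambda>s. \<Sum>i\<le>degree p. coeff p i * (s ^ i / exp s)) \<longlongrightarrow> (\<Sum>i\<le>degree p. coeff p i * 0)) at_top"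
    by (intro tendsto_sum tendsto_mult tendsto_const tendsto_power_div_exp_0)
  moreover have "poly p s * exp (- s) = (\<Sum>i\<le>degree p. coeff p i * (s ^ i / exp s))" for s
    by (simp add: poly_altdef sum_distrib_right exp_minus divide_inverse mult.assoc)
  ultimately show ?thesis by simp
qed

text \<open>Functions of this form are closed under differentiation, so they are all smooth.\<close>

definition flat :: "real poly \<Rightarrow> real \<Rightarrow> real" where
  "flat p t = (if t > 0 then poly p (1 / t) * exp (- (1 / t)) else 0)"

text \<open>With s = 1/t, the chain rule turns p(s) exp(-s) into s^2 (p - p')(s) exp(-s), and
  \<open>monom 1 2\<close> is s^2. At the origin the exponential decay beats every power of s, so
  both one-sided difference quotients tend to 0.\<close>

lemma DERIV_flat:
  "DERIV (flat p) t :> flat (monom 1 2 * (p - pderiv p)) t"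
proof -
  consider "t < 0" | "t = 0" | "t > 0" by linarith
  then show ?thesis
  proof cases
    case 1
    have "DERIV (flat p) t :> 0"
      by (rule has_field_derivative_transform_within_open[of "\<lambda>_. 0" 0 t "{..<0}"])
        (use 1 in \<open>auto simp: flat_def\<close>)
    then show ?thesis using 1 by (simp add: flat_def)
  next
    case 3
    have "DERIV (\<lambda>t. poly p (1 / t) * exp (- (1 / t))) t :>
        flat (monom 1 2 * (p - pderiv p)) t"
      using 3 by (auto intro!: derivative_eq_intros DERIV_chain2[OF poly_DERIV]
          simp: flat_def poly_monom power2_eq_square field_simps)
    then show ?thesis
      by (rule has_field_derivative_transform_within_open[of _ _ _ "{0<..}"])
        (use 3 in \<open>auto simp: flat_def\<close>)
  next
    case 2
    \<comment> \<open>In terms of s = 1/h the right difference quotient is s p(s) exp(-s), hence the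
      factor \<open>monom 1 1\<close>.\<close>
    have "((\<lambda>h. poly (monom 1 1 * p) (inverse h) * exp (- inverse h)) \<longlongrightarrow> 0) (at_right 0)"
      by (rule filterlim_compose[OF poly_times_exp_minus_tendsto_0 filterlim_inverse_at_top_right])
    then have "((\<lambda>h. flat p h / h) \<longlongrightarrow> 0) (at_right 0)"
      by (rule Lim_transform_eventually)
        (auto simp: eventually_at_right_field flat_def poly_monom inverse_eq_divide field_simps
          intro!: exI[of _ 1])
    moreover have "((\<lambda>h. flat p h / h) \<longlongrightarrow> 0) (at_left 0)"
      by (rule Lim_transform_eventually[OF tendsto_const])
        (auto simp: eventually_at_left_field flat_def intro!: exI[of _ "-1"])
    ultimately have "((\<lambda>h. flat p h / h) \<longlongrightarrow> 0) (at 0)"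
      by (simp add: filterlim_split_at_real)
    then show ?thesis
      using 2 by (simp add: DERIV_def flat_def)
  qed
qed

lemma Ck_on_flat: "Ck_on k UNIV (flat p)"
proof (induction k arbitrary: p)
  case 0
  show ?case
    by (auto intro!: continuous_at_imp_continuous_on DERIV_isCont[OF DERIV_flat])
next
  case (Suc k)
  then show ?case
    by (auto intro!: exI[of _ "flat (monom 1 2 * (p - pderiv p))"] DERIV_flat)
qed

text \<open>The quotient a / (a + b), where a is positive exactly below 4 and b exactly above 1, so
  that the denominator never vanishes. The thresholds 1 and 4 are the squares of 1 and 2, because
  the step will be applied to a squared distance divided by the squared radius.\<close>

lemma smooth_step_exists:
  obtains h :: "real \<Rightarrow> real" where "\<And>k. Ck_on k UNIV h" "\<And>t. 0 \<le> h t" "\<And>t. h t \<le> 1"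
    "\<And>t. t \<le> 1 \<Longrightarrow> h t = 1" "\<And>t. t \<ge> 4 \<Longrightarrow> h t = 0"
proof
  let ?a = "\<lambda>t::real. flat 1 (4 + (- 1) * (t \<bullet> 1))" and ?b = "\<lambda>t::real. flat 1 (t \<bullet> 1 + (-1))"
  have nonneg: "0 \<le> flat 1 t" for t by (simp add: flat_def)
  have pos: "0 < ?a t + ?b t" for t
    by (auto simp: flat_def add_pos_pos)
  have k: "Ck_on k UNIV ?a" "Ck_on k UNIV ?b" for k
    by (intro Ck_on_compose_real[OF Ck_on_flat] Ck_on_add Ck_on_mult Ck_on_const Ck_on_inner_left)+
  let ?h = "\<lambda>t. ?a t * inverse (?a t + ?b t)"
  show "Ck_on k UNIV ?h" for k
    using pos by (intro Ck_on_mult k Ck_on_inverse Ck_on_add) (metis less_irrefl)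
  show "0 \<le> ?h t" for t
    using pos[of t] nonneg by (simp add: less_imp_le)
  show "?h t \<le> 1" for t
    using pos[of t] nonneg by (simp add: divide_inverse[symmetric])
  show "?h t = 1" if "t \<le> 1" for t
    using that by (simp add: flat_def)
  show "?h t = 0" if "t \<ge> 4" for t
    using that by (simp add: flat_def)
qed

subsection \<open>Integration by parts and test functions\<close>

lemma GDERIV_zero_outside:
  assumes "closed C" "\<And>x. x \<notin> C \<Longrightarrow> F x = 0" "x \<notin> C"
  shows "GDERIV F x :> 0"
  unfolding gderiv_def
  by (rule has_derivative_transform_within_open[of "\<lambda>_. 0" _ _ UNIV "- C"]) (use assms in auto)

lemma continuous_compact_support_bounded:
  fixes f :: "'a::euclidean_space \<Rightarrow> 'b::real_normed_vector"
  assumes "compact C" "continuous_on C f" "\<And>x. x \<notin> C \<Longrightarrow> f x = 0"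
  obtains M where "M > 0" "\<And>x. norm (f x) \<le> M"
proof -
  have "bounded (f ` C)"
    using assms compact_continuous_image compact_imp_bounded by blast
  then obtain M where "M > 0" "\<And>x. x \<in> C \<Longrightarrow> norm (f x) \<le> M"
    by (auto simp: bounded_pos)
  then show ?thesis
    using that[of M] assms(3) by (metis less_imp_le norm_zero)
qed

lemma integrable_compact_support:
  fixes f :: "'a::euclidean_space \<Rightarrow> 'b::euclidean_space"
  assumes "compact C" "continuous_on UNIV f" "\<And>x. x \<notin> C \<Longrightarrow> f x = 0"
  shows "integrable lborel f" "integrable lebesgue f"
proof -
  have "(\<lambda>x. indicator C x *\<^sub>R f x) = f"
    using assms(3) by (auto simp: indicator_def)
  then show "integrable lborel f"
    using borel_integrable_compact[OF assms(1) continuous_on_subset[OF assms(2)]] by simp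
  then show "integrable lebesgue f"
    by (simp add: integrable_completion borel_measurable_integrable)
qed

lemma integral_lborel_translate:
  fixes F :: "'a::euclidean_space \<Rightarrow> real"
  assumes "F \<in> borel_measurable borel"
  shows "(LINT x|lborel. F (a + x)) = (LINT x|lborel. F x)"
proof -
  have "(LINT x|lborel. F x) = (LINT x|distr lborel borel ((+) a). F x)"
    by (simp add: lborel_distr_plus)
  also have "\<dots> = (LINT x|lborel. F (a + x))"
    using assms by (subst integral_distr) auto
  finally show ?thesis by simp
qed

text \<open>By translation invariance the integrals of the difference quotients vanish; they are
  dominated because \<open>F\<close> is Lipschitz with compact support.\<close>

lemma integral_gradient_component_0:
  fixes F :: "'a::euclidean_space \<Rightarrow> real"
  assumes C: "compact C" "\<And>x. x \<notin> C \<Longrightarrow> F x = 0"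
    and D: "\<And>x. GDERIV F x :> D x" "continuous_on UNIV D"
  shows "(LINT x|lebesgue. D x \<bullet> v) = 0"
proof -
  define a :: "nat \<Rightarrow> real" where "a k = inverse (real (Suc k))" for k
  define s where "s k x = (F (a k *\<^sub>R v + x) - F x) / a k" for k x
  have a: "a \<longlonglongrightarrow> 0" "\<And>k. 0 < a k" "\<And>k. a k \<le> 1"
    unfolding a_def using LIMSEQ_inverse_real_of_nat by (auto simp: field_simps)
  have D0: "D x = 0" if "x \<notin> C" for x
    using GDERIV_unique[OF D(1) GDERIV_zero_outside[OF compact_imp_closed[OF C(1)] C(2) that]]
    by blast
  obtain M where M: "M > 0" "\<And>x. norm (D x) \<le> M"
    using continuous_compact_support_bounded[OF C(1) continuous_on_subset[OF D(2)] D0] by auto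
  have contF: "continuous_on UNIV F"
    using D(1) by (auto intro!: continuous_at_imp_continuous_on dest: GDERIV_isCont)
  have Lip: "\<bar>F y - F x\<bar> \<le> M * norm (y - x)" for x y
  proof -
    have "\<bar>h \<bullet> D z\<bar> \<le> M * norm h" for h z
      using Cauchy_Schwarz_ineq2[of h "D z"] mult_left_mono[OF M(2)[of z], of "norm h"]
      by (simp add: mult.commute)
    then have "norm (F y - F x) \<le> M * norm (y - x)"
      using D(1)
      by (intro differentiable_bound[of UNIV _ "\<lambda>x h. h \<bullet> D x"] onorm_le)
        (auto simp: gderiv_def)
    then show ?thesis by simp
  qed
  have F_lborel: "integrable lborel F"
    using integrable_compact_support[OF C(1) contF C(2)] by simp
  have Fm: "F \<in> borel_measurable borel"
    using contF by (rule borel_measurable_continuous_onI)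
  have shifted: "integrable lborel (\<lambda>x. F (a k *\<^sub>R v + x))" for k
  proof -
    have "integrable (distr lborel borel ((+) (a k *\<^sub>R v))) F"
      using F_lborel by (simp add: lborel_distr_plus)
    then show ?thesis using Fm by (subst (asm) integrable_distr_eq) auto
  qed
  have s0: "(LINT x|lborel. s k x) = 0" for k
    unfolding s_def using F_lborel shifted integral_lborel_translate[OF Fm, of "a k *\<^sub>R v"] by simp
  obtain R where R: "\<And>x. x \<in> C \<Longrightarrow> norm x \<le> R"
    using compact_imp_bounded[OF C(1)] by (auto simp: bounded_iff)
  \<comment> \<open>Since \<open>a k \<le> 1\<close>, this ball contains the support of
    \<open>F\<close> and of all its translates, so one integrable bound serves every
    \<open>k\<close>.\<close>
  define B where "B = cball (0::'a) (R + norm v)"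
  have bound: "norm (s k x) \<le> indicator B x *\<^sub>R (M * norm v)" for k x
  proof (cases "x \<in> B")
    case True
    have "\<bar>F (a k *\<^sub>R v + x) - F x\<bar> \<le> M * (a k * norm v)"
      using Lip[of "a k *\<^sub>R v + x" x] a(2)[of k] by simp
    then show ?thesis
      using True a(2)[of k] by (simp add: s_def field_simps)
  next
    case False
    have "norm (a k *\<^sub>R v) \<le> norm v"
      using a(2,3)[of k] mult_right_mono[of "a k" 1 "norm v"] by simp
    moreover have "norm x > R + norm v" using False by (simp add: B_def)
    ultimately have "norm (a k *\<^sub>R v + x) > R" "norm x > R"
      using norm_diff_ineq[of x "a k *\<^sub>R v"] norm_ge_zero[of v]
      by (auto simp: add.commute simp del: norm_ge_zero norm_scaleR)
    then have "a k *\<^sub>R v + x \<notin> C" "x \<notin> C" using R by force+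
    then show ?thesis using C(2) False by (simp add: s_def)
  qed
  have lim: "(\<lambda>k. s k x) \<longlonglongrightarrow> D x \<bullet> v" for x
  proof -
    have "((\<lambda>t. F (t *\<^sub>R v + x)) has_derivative (\<lambda>t. (t *\<^sub>R v) \<bullet> D x)) (at 0)"
      using D(1)[of x, unfolded gderiv_def]
      by (intro has_derivative_compose[of "\<lambda>t. t *\<^sub>R v + x" "\<lambda>t. t *\<^sub>R v" 0 UNIV F])
        (auto intro!: derivative_eq_intros)
    then have "DERIV (\<lambda>t. F (t *\<^sub>R v + x)) 0 :> D x \<bullet> v"
      by (simp add: has_field_derivative_def inner_commute mult_commute_abs)
    then have "((\<lambda>h. (F (h *\<^sub>R v + x) - F x) / h) \<longlongrightarrow> D x \<bullet> v) (at 0)"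
      by (simp add: DERIV_def)
    moreover have "filterlim a (at 0) sequentially"
      using a(1,2) by (simp add: filterlim_at less_imp_neq[symmetric])
    ultimately show ?thesis
      unfolding s_def by (rule filterlim_compose)
  qed
  have Dm: "(\<lambda>x. D x \<bullet> v) \<in> borel_measurable borel"
    using D(2) by (intro borel_measurable_continuous_onI continuous_intros)
  have "(\<lambda>k. LINT x|lborel. s k x) \<longlonglongrightarrow> (LINT x|lborel. D x \<bullet> v)"
  proof (rule integral_dominated_convergence[where w="\<lambda>x. indicator B x *\<^sub>R (M * norm v)"])
    show "integrable lborel (\<lambda>x. indicator B x *\<^sub>R (M * norm v))"
      by (rule borel_integrable_compact) (auto simp: B_def)
    show "s k \<in> borel_measurable lborel" for k
      unfolding s_def using Fm by measurable
  qed (use Dm lim bound in \<open>auto\<close>)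
  then have "(LINT x|lborel. D x \<bullet> v) = 0"
    by (simp add: s0 LIMSEQ_const_iff)
  then show ?thesis using Dm by (simp add: integral_completion)
qed

section \<open>Test functions: closure properties and integrability\<close>

lemma test_functionsI:
  assumes "\<And>k. Ck_on k UNIV \<phi>" "compact C" "C \<subseteq> U" "\<And>x. x \<notin> C \<Longrightarrow> \<phi> x = 0"
  shows "\<phi> \<in> test_functions U"
proof -
  have "closure {x. \<phi> x \<noteq> 0} \<subseteq> C"
    using assms by (intro closure_minimal) (auto intro: compact_imp_closed)
  moreover from this have "compact (closure {x. \<phi> x \<noteq> 0})"
    using compact_Int_closed[OF assms(2) closed_closure] by (metis inf.absorb_iff2)
  ultimately show ?thesis
    using assms(1,3) by (auto simp: test_functions_def)
qed

lemma test_functions_Ck_on: "\<phi> \<in> test_functions U \<Longrightarrow> Ck_on k UNIV \<phi>"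
  by (simp add: test_functions_def)

lemma smooth_GDERIV:
  assumes "\<And>k. Ck_on k UNIV f"
  shows "GDERIV f x :> grad f x"
proof -
  obtain D where "\<And>x. GDERIV f x :> D x"
    using assms[of "Suc 0"] by auto
  then show ?thesis using grad_eqI by metis
qed

lemma smooth_grad:
  assumes "\<And>k. Ck_on k UNIV f" "b \<in> Basis"
  shows "Ck_on k UNIV (\<lambda>x. grad f x \<bullet> b)"
proof -
  obtain D where D: "\<And>x. GDERIV f x :> D x" "\<And>b. b \<in> Basis \<Longrightarrow> Ck_on k UNIV (\<lambda>x. D x \<bullet> b)"
    using assms(1)[of "Suc k"] by auto
  moreover have "grad f = D" using D grad_eqI by blast
  ultimately show ?thesis using assms(2) by blast
qed

lemma smooth_continuous: "(\<And>k. Ck_on k UNIV f) \<Longrightarrow> continuous_on UNIV f"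
  by (simp flip: Ck_on.simps(1))

lemma smooth_continuous_grad:
  assumes "\<And>k. Ck_on k UNIV f"
  shows "continuous_on UNIV (grad f)"
  unfolding continuous_on_componentwise[of UNIV "grad f"]
  using smooth_grad[OF assms, of _ 0] by simp

lemmas test_functions_GDERIV = smooth_GDERIV[OF test_functions_Ck_on]

lemma test_functions_support:
  assumes "\<phi> \<in> test_functions U"
  obtains C where "compact C" "C \<subseteq> U" "\<And>x. x \<notin> C \<Longrightarrow> \<phi> x = 0" "\<And>x. x \<notin> C \<Longrightarrow> grad \<phi> x = 0"
proof
  let ?C = "closure {x. \<phi> x \<noteq> 0}"
  show "compact ?C" "?C \<subseteq> U" using assms by (auto simp: test_functions_def)
  show *: "\<phi> x = 0" if "x \<notin> ?C" for x
    using that closure_subset[of "{x. \<phi> x \<noteq> 0}"] by blast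
  show "grad \<phi> x = 0" if "x \<notin> ?C" for x
    by (rule grad_eqI, rule GDERIV_zero_outside[OF closed_closure * that])
qed

lemma test_functions_mono: "U \<subseteq> V \<Longrightarrow> test_functions U \<subseteq> test_functions V"
  by (auto simp: test_functions_def)

lemma test_functions_outside:
  assumes "\<phi> \<in> test_functions U" "x \<notin> U"
  shows "\<phi> x = 0" "grad \<phi> x = 0"
proof -
  obtain C where "C \<subseteq> U" "\<And>x. x \<notin> C \<Longrightarrow> \<phi> x = 0" "\<And>x. x \<notin> C \<Longrightarrow> grad \<phi> x = 0"
    by (rule test_functions_support[OF assms(1)]) blast
  then show "\<phi> x = 0" "grad \<phi> x = 0" using assms(2) by auto
qed

lemma grad_add_scale:
  assumes "\<phi> \<in> test_functions U" "\<psi> \<in> test_functions V"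
  shows "grad (\<lambda>x. \<phi> x + c * \<psi> x) x = grad \<phi> x + c *\<^sub>R grad \<psi> x"
  using GDERIV_add[OF test_functions_GDERIV[OF assms(1)]
      GDERIV_mult[OF GDERIV_const test_functions_GDERIV[OF assms(2)]]]
  by (intro grad_eqI) simp

lemma test_functions_add_scale:
  assumes "\<phi> \<in> test_functions U" "\<psi> \<in> test_functions U"
  shows "(\<lambda>x. \<phi> x + c * \<psi> x) \<in> test_functions U"
proof -
  obtain C where "compact C" "C \<subseteq> U" "\<And>x. x \<notin> C \<Longrightarrow> \<phi> x = 0"
    by (rule test_functions_support[OF assms(1)]) blast
  moreover obtain C' where "compact C'" "C' \<subseteq> U" "\<And>x. x \<notin> C' \<Longrightarrow> \<psi> x = 0"
    by (rule test_functions_support[OF assms(2)]) blast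
  ultimately show ?thesis
    using assms by (intro test_functionsI[of _ "C \<union> C'"] Ck_on_add Ck_on_mult Ck_on_const)
      (auto dest: test_functions_Ck_on)
qed

lemma test_functions_grad:
  assumes "\<phi> \<in> test_functions U" "b \<in> Basis"
  shows "(\<lambda>x. grad \<phi> x \<bullet> b) \<in> test_functions U"
proof -
  obtain C where "compact C" "C \<subseteq> U" "\<And>x. x \<notin> C \<Longrightarrow> grad \<phi> x = 0"
    by (rule test_functions_support[OF assms(1)]) blast
  then show ?thesis
    using smooth_grad[OF test_functions_Ck_on[OF assms(1)] assms(2)] by (intro test_functionsI[of _ C]) auto
qed

lemma test_functions_smooth_mult:
  assumes "\<And>k. Ck_on k UNIV a" "\<phi> \<in> test_functions U"
  shows "(\<lambda>x. a x * \<phi> x) \<in> test_functions U"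
proof -
  obtain C where "compact C" "C \<subseteq> U" "\<And>x. x \<notin> C \<Longrightarrow> \<phi> x = 0"
    by (rule test_functions_support[OF assms(2)]) blast
  then show ?thesis
    using assms test_functions_Ck_on[OF assms(2)] by (intro test_functionsI[of _ C] Ck_on_mult) auto
qed

lemma grad_mult:
  assumes "\<And>k. Ck_on k UNIV f" "\<And>k. Ck_on k UNIV g"
  shows "grad (\<lambda>x. f x * g x) x = f x *\<^sub>R grad g x + g x *\<^sub>R grad f x"
  by (rule grad_eqI, rule GDERIV_mult) (rule smooth_GDERIV, rule assms)+

lemma test_functions_integrable:
  assumes "\<phi> \<in> test_functions U"
  shows "integrable lebesgue (\<lambda>x. (\<phi> x)\<^sup>2)" "integrable lebesgue (\<lambda>x. (norm (grad \<phi> x))\<^sup>2)"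
    "\<phi> \<in> borel_measurable lebesgue" "grad \<phi> \<in> borel_measurable lebesgue"
proof -
  obtain C where "compact C" "\<And>x. x \<notin> C \<Longrightarrow> \<phi> x = 0" "\<And>x. x \<notin> C \<Longrightarrow> grad \<phi> x = 0"
    by (rule test_functions_support[OF assms]) blast
  moreover have cont: "continuous_on UNIV \<phi>" "continuous_on UNIV (grad \<phi>)"
    using smooth_continuous smooth_continuous_grad test_functions_Ck_on[OF assms] by blast+
  ultimately show "integrable lebesgue (\<lambda>x. (\<phi> x)\<^sup>2)" "integrable lebesgue (\<lambda>x. (norm (grad \<phi> x))\<^sup>2)"
    by (intro integrable_compact_support(2)[of C] continuous_intros; simp)+
  show "\<phi> \<in> borel_measurable lebesgue" "grad \<phi> \<in> borel_measurable lebesgue"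
    using cont[THEN borel_measurable_continuous_onI] by (simp_all add: measurable_completion)
qed

subsection \<open>Weak gradients\<close>

text \<open>Young's inequality, from the square of \<open>t *\<^sub>R x - y\<close>. The free weight
  allows the factor on the main term to be as close to 1 as desired, at the price of a large factor
  on the small term.\<close>

lemma norm_add_power2_le_weighted:
  fixes x y :: "'a::real_inner"
  assumes "t > 0"
  shows "(norm (x + y))\<^sup>2 \<le> (1 + t) * (norm x)\<^sup>2 + (1 + 1 / t) * (norm y)\<^sup>2"
proof -
  have "0 \<le> (norm (t *\<^sub>R x - y))\<^sup>2 / t"
    using assms by simp
  also have "(norm (t *\<^sub>R x - y))\<^sup>2 / t = t * (x \<bullet> x) - 2 * (x \<bullet> y) + (y \<bullet> y) / t"
    using assms by (simp add: power2_norm_eq_inner inner_diff inner_commute field_simps)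
  finally show ?thesis
    by (simp add: power2_norm_eq_inner inner_add inner_commute algebra_simps)
qed

section \<open>Square-integrable functions on an open set\<close>

lemma L2_on_add:
  assumes "L2_on U f" "L2_on U g"
  shows "L2_on U (\<lambda>x. f x + g x)"
  unfolding L2_on_def
proof
  show "integrable (lebesgue_on U) (\<lambda>x. (norm (f x + g x))\<^sup>2)"
  proof (rule Bochner_Integration.integrable_bound)
    show "integrable (lebesgue_on U) (\<lambda>x. 2 * (norm (f x))\<^sup>2 + 2 * (norm (g x))\<^sup>2)"
      using assms by (auto simp: L2_on_def)
    show "AE x in lebesgue_on U. norm ((norm (f x + g x))\<^sup>2)
        \<le> norm (2 * (norm (f x))\<^sup>2 + 2 * (norm (g x))\<^sup>2)"
      using norm_add_power2_le_weighted[of 1] by (intro AE_I2) (simp add: one_add_one)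
  qed (use assms in \<open>auto simp: L2_on_def\<close>)
qed (use assms in \<open>auto simp: L2_on_def\<close>)

lemma L2_on_scaleR_bounded:
  fixes a :: "'a::euclidean_space \<Rightarrow> real" and f :: "'a \<Rightarrow> 'b::euclidean_space"
  assumes "a \<in> borel_measurable (lebesgue_on U)" "\<And>x. \<bar>a x\<bar> \<le> M" "L2_on U f"
  shows "L2_on U (\<lambda>x. a x *\<^sub>R f x)"
  unfolding L2_on_def
proof
  show "integrable (lebesgue_on U) (\<lambda>x. (norm (a x *\<^sub>R f x))\<^sup>2)"
  proof (rule Bochner_Integration.integrable_bound)
    show "integrable (lebesgue_on U) (\<lambda>x. M\<^sup>2 * (norm (f x))\<^sup>2)"
      using assms by (auto simp: L2_on_def)
    show "AE x in lebesgue_on U. norm ((norm (a x *\<^sub>R f x))\<^sup>2) \<le> norm (M\<^sup>2 * (norm (f x))\<^sup>2)"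
      using power_mono[OF assms(2) abs_ge_zero, of _ 2]
      by (intro AE_I2) (simp add: power_mult_distrib mult_right_mono)
  qed (use assms in \<open>auto simp: L2_on_def\<close>)
qed (use assms in \<open>auto simp: L2_on_def\<close>)

lemma L2_on_scaleR_vector:
  fixes v :: "'a::euclidean_space \<Rightarrow> 'b::euclidean_space" and f :: "'a \<Rightarrow> real"
  assumes "v \<in> borel_measurable (lebesgue_on U)" "\<And>x. norm (v x) \<le> M" "L2_on U f"
  shows "L2_on U (\<lambda>x. f x *\<^sub>R v x)"
proof -
  have "L2_on U (\<lambda>x. norm (v x) *\<^sub>R f x)"
    using assms by (intro L2_on_scaleR_bounded[where M=M]) auto
  then show ?thesis
    using assms(1,3) by (auto simp: L2_on_def power_mult_distrib mult.commute)
qed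

lemma L2_on_scaleR: "L2_on U f \<Longrightarrow> L2_on U (\<lambda>x. c *\<^sub>R f x)"
  using L2_on_scaleR_bounded[of "\<lambda>_. c" U "\<bar>c\<bar>" f] by simp

lemma L2_on_diff: "L2_on U f \<Longrightarrow> L2_on U g \<Longrightarrow> L2_on U (\<lambda>x. f x - g x)"
  using L2_on_add[OF _ L2_on_scaleR[of U g "-1"], of f] by simp

lemma L2_on_inner_integrable:
  assumes "L2_on U f" "L2_on U g"
  shows "integrable (lebesgue_on U) (\<lambda>x. f x \<bullet> g x)"
proof (rule Bochner_Integration.integrable_bound)
  show "integrable (lebesgue_on U) (\<lambda>x. (norm (f x))\<^sup>2 + (norm (g x))\<^sup>2)"
    using assms by (auto simp: L2_on_def)
  have "\<bar>f x \<bullet> g x\<bar> \<le> (norm (f x))\<^sup>2 + (norm (g x))\<^sup>2" for x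
    using Cauchy_Schwarz_ineq2[of "f x" "g x"] sum_squares_bound[of "norm (f x)" "norm (g x)"]
      mult_nonneg_nonneg[OF norm_ge_zero[of "f x"] norm_ge_zero[of "g x"]]
    by linarith
  then show "AE x in lebesgue_on U. norm (f x \<bullet> g x) \<le> norm ((norm (f x))\<^sup>2 + (norm (g x))\<^sup>2)"
    by (intro AE_I2) simp
qed (use assms in \<open>auto simp: L2_on_def\<close>)

lemma L2_on_mult_integrable:
  fixes f g :: "'a::euclidean_space \<Rightarrow> real"
  shows "L2_on U f \<Longrightarrow> L2_on U g \<Longrightarrow> integrable (lebesgue_on U) (\<lambda>x. f x * g x)"
  using L2_on_inner_integrable[of U f g] by simp

lemma L2_on_component: "L2_on U f \<Longrightarrow> L2_on U (\<lambda>x. f x \<bullet> b)"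
proof -
  assume f: "L2_on U f"
  have "integrable (lebesgue_on U) (\<lambda>x. (norm (f x \<bullet> b))\<^sup>2)"
  proof (rule Bochner_Integration.integrable_bound)
    show "integrable (lebesgue_on U) (\<lambda>x. (norm b)\<^sup>2 * (norm (f x))\<^sup>2)"
      using f by (auto simp: L2_on_def)
    have "(f x \<bullet> b)\<^sup>2 \<le> (norm b)\<^sup>2 * (norm (f x))\<^sup>2" for x
      using Cauchy_Schwarz_ineq[of "f x" b] by (simp add: power2_norm_eq_inner mult.commute)
    then show "AE x in lebesgue_on U. norm ((norm (f x \<bullet> b))\<^sup>2) \<le> norm ((norm b)\<^sup>2 * (norm (f x))\<^sup>2)"
      by (intro AE_I2) simp
  qed (use f in \<open>auto simp: L2_on_def\<close>)
  then show ?thesis using f by (auto simp: L2_on_def)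
qed

lemma L2_on_restrict:
  assumes "open U" "L2_on UNIV f"
  shows "L2_on U f" "(LINT x|lebesgue_on U. (norm (f x))\<^sup>2) \<le> (LINT x|lebesgue. (norm (f x))\<^sup>2)"
proof -
  have U: "U \<in> sets lebesgue" using assms(1) by auto
  have f: "f \<in> borel_measurable lebesgue" "integrable lebesgue (\<lambda>x. (norm (f x))\<^sup>2)"
    using assms(2) by (auto simp: L2_on_def lebesgue_on_UNIV_eq)
  have "integrable lebesgue (\<lambda>x. indicat_real U x *\<^sub>R (norm (f x))\<^sup>2)"
    using integrable_mult_indicator[OF U f(2)] .
  then show "L2_on U f"
    using f U by (simp add: L2_on_def integrable_restrict_space measurable_restrict_space1)
  show "(LINT x|lebesgue_on U. (norm (f x))\<^sup>2) \<le> (LINT x|lebesgue. (norm (f x))\<^sup>2)"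
    using U integrable_mult_indicator[OF U f(2)] f(2)
    by (auto simp: integral_restrict_space indicator_def intro!: integral_mono)
qed

lemma integral_lebesgue_on_support:
  fixes f :: "'a::euclidean_space \<Rightarrow> 'b::euclidean_space"
  assumes "open U" "\<And>x. x \<notin> U \<Longrightarrow> f x = 0"
  shows "(LINT x|lebesgue_on U. f x) = (LINT x|lebesgue. f x)"
proof -
  have "(\<lambda>x. indicat_real U x *\<^sub>R f x) = f"
    using assms(2) by (auto simp: indicator_def)
  then show ?thesis
    using assms(1) by (subst integral_restrict_space) auto
qed

lemma integral_norm_add_power2_le:
  assumes "L2_on U f" "L2_on U g" "t > 0"
  shows "(LINT x|lebesgue_on U. (norm (f x + g x))\<^sup>2)
    \<le> (1 + t) * (LINT x|lebesgue_on U. (norm (f x))\<^sup>2) + (1 + 1 / t) * (LINT x|lebesgue_on U. (norm (g x))\<^sup>2)"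
proof -
  have "integrable (lebesgue_on U) (\<lambda>x. (norm (f x))\<^sup>2)" "integrable (lebesgue_on U) (\<lambda>x. (norm (g x))\<^sup>2)"
    "integrable (lebesgue_on U) (\<lambda>x. (norm (f x + g x))\<^sup>2)"
    using assms L2_on_add[OF assms(1,2)] by (auto simp: L2_on_def)
  moreover from this have "(LINT x|lebesgue_on U. (norm (f x + g x))\<^sup>2)
    \<le> (LINT x|lebesgue_on U. (1 + t) * (norm (f x))\<^sup>2 + (1 + 1 / t) * (norm (g x))\<^sup>2)"
    using norm_add_power2_le_weighted[OF assms(3)]
    by (intro integral_mono) auto
  ultimately show ?thesis by simp
qed

lemma L2_tendsto_add:
  assumes "\<And>k. L2_on U (f k)" "\<And>k. L2_on U (g k)"
    "(\<lambda>k. LINT x|lebesgue_on U. (norm (f k x))\<^sup>2) \<longlonglongrightarrow> 0"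
    "(\<lambda>k. LINT x|lebesgue_on U. (norm (g k x))\<^sup>2) \<longlonglongrightarrow> 0"
  shows "(\<lambda>k. LINT x|lebesgue_on U. (norm (f k x + g k x))\<^sup>2) \<longlonglongrightarrow> 0"
proof (rule tendsto_sandwich[where f="\<lambda>_. 0"])
  show "(\<lambda>k. 2 * (LINT x|lebesgue_on U. (norm (f k x))\<^sup>2) + 2 * (LINT x|lebesgue_on U. (norm (g k x))\<^sup>2))
    \<longlonglongrightarrow> 0"
    using tendsto_add[OF tendsto_mult[OF tendsto_const assms(3), of 2] tendsto_mult[OF tendsto_const assms(4), of 2]]
    by simp
  show "\<forall>\<^sub>F k in sequentially. (LINT x|lebesgue_on U. (norm (f k x + g k x))\<^sup>2)
    \<le> 2 * (LINT x|lebesgue_on U. (norm (f k x))\<^sup>2) + 2 * (LINT x|lebesgue_on U. (norm (g k x))\<^sup>2)"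
    using integral_norm_add_power2_le[OF assms(1,2), of 1] by simp
qed auto

lemma L2_tendsto_bounded_mult:
  assumes "\<And>k. L2_on U (f k)" "\<And>k. L2_on U (g k)" "\<And>k x. norm (g k x) \<le> M * norm (f k x)"
    "(\<lambda>k. LINT x|lebesgue_on U. (norm (f k x))\<^sup>2) \<longlonglongrightarrow> 0"
  shows "(\<lambda>k. LINT x|lebesgue_on U. (norm (g k x))\<^sup>2) \<longlonglongrightarrow> 0"
proof (rule tendsto_sandwich[where f="\<lambda>_. 0"])
  show "(\<lambda>k. M\<^sup>2 * (LINT x|lebesgue_on U. (norm (f k x))\<^sup>2)) \<longlonglongrightarrow> 0"
    using tendsto_mult[OF tendsto_const assms(4), of "M\<^sup>2"] by simp
  have "(LINT x|lebesgue_on U. (norm (g k x))\<^sup>2) \<le> (LINT x|lebesgue_on U. M\<^sup>2 * (norm (f k x))\<^sup>2)" for k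
    using assms(1,2)[of k] power_mono[OF assms(3) norm_ge_zero, of k _ 2]
    by (intro integral_mono) (auto simp: L2_on_def power_mult_distrib)
  then show "\<forall>\<^sub>F k in sequentially. (LINT x|lebesgue_on U. (norm (g k x))\<^sup>2)
    \<le> M\<^sup>2 * (LINT x|lebesgue_on U. (norm (f k x))\<^sup>2)"
    by simp
qed auto

lemma test_functions_L2:
  assumes "\<phi> \<in> test_functions V" "open U"
  shows "L2_on U \<phi>" "L2_on U (grad \<phi>)"
proof -
  have "L2_on UNIV \<phi>" "L2_on UNIV (grad \<phi>)"
    using test_functions_integrable[OF assms(1)] by (simp_all add: L2_on_def lebesgue_on_UNIV_eq)
  then show "L2_on U \<phi>" "L2_on U (grad \<phi>)"
    by (simp_all add: L2_on_restrict(1)[OF assms(2)])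
qed

lemma H1_grad_add_scale:
  assumes "open U" "H1_grad U f g" "H1_grad U f' g'"
  shows "H1_grad U (\<lambda>x. f x + c * f' x) (\<lambda>x. g x + c *\<^sub>R g' x)"
  unfolding H1_grad_def
proof (intro conjI ballI)
  have L2: "L2_on U f" "L2_on U g" "L2_on U f'" "L2_on U g'"
    using assms by (auto simp: H1_grad_def)
  show "L2_on U (\<lambda>x. f x + c * f' x)" "L2_on U (\<lambda>x. g x + c *\<^sub>R g' x)"
    using L2_on_add[OF L2(1) L2_on_scaleR[OF L2(3), of c]] L2_on_add[OF L2(2) L2_on_scaleR[OF L2(4), of c]]
    by simp_all
  fix \<phi> and b :: 'a assume \<phi>: "\<phi> \<in> test_functions U" and b: "b \<in> Basis"
  have "(LINT x|lebesgue_on U. f x * (grad \<phi> x \<bullet> b) + c * (f' x * (grad \<phi> x \<bullet> b))) =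
    - (LINT x|lebesgue_on U. (g x \<bullet> b) * \<phi> x + c * ((g' x \<bullet> b) * \<phi> x))"
    using L2 assms \<phi> b test_functions_L2[OF \<phi> assms(1)]
    by (simp add: L2_on_mult_integrable L2_on_component H1_grad_def algebra_simps)
  then show "(LINT x|lebesgue_on U. (f x + c * f' x) * (grad \<phi> x \<bullet> b)) =
    - (LINT x|lebesgue_on U. ((g x + c *\<^sub>R g' x) \<bullet> b) * \<phi> x)"
    by (simp add: algebra_simps)
qed

text \<open>Integration by parts says that the gradient of \<open>F \<phi>\<close> integrates to
  zero componentwise. Only one continuous derivative is asked of \<open>F\<close>, so that products
  involving \<open>u\<close> are covered.\<close>

lemma H1_grad_C1_compact_support:
  assumes "open U" "compact C" "C \<subseteq> U" "\<And>x. x \<notin> C \<Longrightarrow> F x = 0"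
    "\<And>x. GDERIV F x :> D x" "continuous_on UNIV D"
  shows "H1_grad U F D"
proof -
  have D0: "D x = 0" if "x \<notin> C" for x
    using GDERIV_unique[OF assms(5) GDERIV_zero_outside[OF compact_imp_closed[OF assms(2)] assms(4) that]]
    by blast
  have contF: "continuous_on UNIV F"
    using assms(5) by (auto intro!: continuous_at_imp_continuous_on dest: GDERIV_isCont)
  have "L2_on UNIV F" "L2_on UNIV D"
    using contF assms(6)[THEN borel_measurable_continuous_onI] contF[THEN borel_measurable_continuous_onI]
      assms(4,6) D0
    by (auto simp: L2_on_def lebesgue_on_UNIV_eq measurable_completion
        intro!: integrable_compact_support(2)[OF assms(2)] continuous_intros)
  note L2 = this[THEN L2_on_restrict(1)[OF assms(1)]]
  have "(LINT x|lebesgue_on U. F x * (grad \<phi> x \<bullet> b)) + (LINT x|lebesgue_on U. (D x \<bullet> b) * \<phi> x) = 0"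
    if \<phi>: "\<phi> \<in> test_functions U" for \<phi> b
  proof -
    let ?E = "\<lambda>x. F x *\<^sub>R grad \<phi> x + \<phi> x *\<^sub>R D x"
    have "(LINT x|lebesgue. ?E x \<bullet> b) = 0"
    proof (rule integral_gradient_component_0[OF assms(2)])
      show "GDERIV (\<lambda>x. F x * \<phi> x) x :> ?E x" for x
        by (rule GDERIV_mult[OF assms(5) test_functions_GDERIV[OF \<phi>]])
      show "continuous_on UNIV ?E"
        using smooth_continuous[OF test_functions_Ck_on[OF \<phi>]]
          smooth_continuous_grad[OF test_functions_Ck_on[OF \<phi>]]
        by (intro continuous_intros contF assms(6))
    qed (use assms(4) in simp)
    moreover have "(LINT x|lebesgue_on U. ?E x \<bullet> b) = (LINT x|lebesgue. ?E x \<bullet> b)"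
      using assms(4) D0 subsetD[OF assms(3)]
      by (intro integral_lebesgue_on_support assms(1)) (metis add_0 inner_zero_left scale_zero_left scale_zero_right)
    ultimately show ?thesis
      using L2 test_functions_L2[OF \<phi> assms(1)]
      by (simp add: inner_add_left L2_on_mult_integrable L2_on_component mult.commute)
  qed
  then show ?thesis
    using L2 by (simp add: H1_grad_def eq_neg_iff_add_eq_0)
qed

lemma H1_grad_test_function:
  assumes "\<phi> \<in> test_functions U" "open U"
  shows "H1_grad U \<phi> (grad \<phi>)"
proof -
  obtain C where "compact C" "C \<subseteq> U" "\<And>x. x \<notin> C \<Longrightarrow> \<phi> x = 0"
    by (rule test_functions_support[OF assms(1)]) blast
  then show ?thesis
    using H1_grad_C1_compact_support[OF assms(2)] test_functions_GDERIV[OF assms(1)]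
      smooth_continuous_grad[OF test_functions_Ck_on[OF assms(1)]] by blast
qed

lemma H1_grad_restrict:
  assumes "open U" "H1_grad UNIV f g"
  shows "H1_grad U f g"
  unfolding H1_grad_def
proof (intro conjI ballI)
  show "L2_on U f" "L2_on U g"
    using assms L2_on_restrict(1) by (auto simp: H1_grad_def)
  fix \<phi> and b :: 'a assume \<phi>: "\<phi> \<in> test_functions U" and b: "b \<in> Basis"
  have "\<phi> \<in> test_functions UNIV" using \<phi> test_functions_mono by blast
  then show "(LINT x|lebesgue_on U. f x * (grad \<phi> x \<bullet> b)) = - (LINT x|lebesgue_on U. (g x \<bullet> b) * \<phi> x)"
    using assms b test_functions_outside[OF \<phi>]
    by (simp add: H1_grad_def lebesgue_on_UNIV_eq integral_lebesgue_on_support[OF assms(1)])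
qed

subsection \<open>The space \<open>H10\<close> and the capacity\<close>

text \<open>Exposes the weak gradient that \<open>H10\<close> hides behind an existential. The
  integrals are written with norms over \<open>lebesgue_on UNIV\<close>, the shape in which the
  lemmas on \<open>L2_on\<close> apply.\<close>

definition H10_grad :: "'a::euclidean_space set \<Rightarrow> ('a \<Rightarrow> real) \<Rightarrow> ('a \<Rightarrow> 'a) \<Rightarrow> bool" where
  "H10_grad U f g \<longleftrightarrow> H1_grad UNIV f g \<and>
     (\<exists>\<phi>. (\<forall>k::nat. \<phi> k \<in> test_functions U) \<and>
       (\<lambda>k. LINT x|lebesgue_on UNIV. (norm (\<phi> k x - f x))\<^sup>2) \<longlonglongrightarrow> 0 \<and>
       (\<lambda>k. LINT x|lebesgue_on UNIV. (norm (grad (\<phi> k) x - g x))\<^sup>2) \<longlonglongrightarrow> 0)"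

lemma mem_H10_iff: "f \<in> H10 U \<longleftrightarrow> (\<exists>g. H10_grad U f g)"
  by (simp add: H10_def H10_grad_def lebesgue_on_UNIV_eq)

lemma H10_grad_test_function: "\<phi> \<in> test_functions U \<Longrightarrow> H10_grad U \<phi> (grad \<phi>)"
  using H1_grad_test_function[of \<phi> UNIV] test_functions_mono[of U UNIV]
  by (auto simp: H10_grad_def intro!: exI[of _ "\<lambda>_. \<phi>"])

lemma H10_grad_add_scale:
  assumes "H10_grad U f g" "H10_grad U f' g'"
  shows "H10_grad U (\<lambda>x. f x + c * f' x) (\<lambda>x. g x + c *\<^sub>R g' x)"
proof -
  have H1: "H1_grad UNIV f g" "H1_grad UNIV f' g'"
    using assms by (auto simp: H10_grad_def)
  then have L2: "L2_on UNIV f" "L2_on UNIV g" "L2_on UNIV f'" "L2_on UNIV g'"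
    by (auto simp: H1_grad_def)
  obtain \<phi> where \<phi>: "\<And>k::nat. \<phi> k \<in> test_functions U"
    "(\<lambda>k. LINT x|lebesgue_on UNIV. (norm (\<phi> k x - f x))\<^sup>2) \<longlonglongrightarrow> 0"
    "(\<lambda>k. LINT x|lebesgue_on UNIV. (norm (grad (\<phi> k) x - g x))\<^sup>2) \<longlonglongrightarrow> 0"
    using assms(1) by (auto simp: H10_grad_def)
  obtain \<psi> where \<psi>: "\<And>k::nat. \<psi> k \<in> test_functions U"
    "(\<lambda>k. LINT x|lebesgue_on UNIV. (norm (\<psi> k x - f' x))\<^sup>2) \<longlonglongrightarrow> 0"
    "(\<lambda>k. LINT x|lebesgue_on UNIV. (norm (grad (\<psi> k) x - g' x))\<^sup>2) \<longlonglongrightarrow> 0"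
    using assms(2) by (auto simp: H10_grad_def)
  have *: "L2_on UNIV (\<lambda>x. \<phi> k x - f x)" "L2_on UNIV (\<lambda>x. grad (\<phi> k) x - g x)"
    "L2_on UNIV (\<lambda>x. \<psi> k x - f' x)" "L2_on UNIV (\<lambda>x. grad (\<psi> k) x - g' x)" for k
    using L2 \<phi>(1) \<psi>(1) by (auto intro!: L2_on_diff intro: test_functions_L2)
  have scaled: "(\<lambda>k. LINT x|lebesgue_on UNIV. (norm (c *\<^sub>R (\<psi> k x - f' x)))\<^sup>2) \<longlonglongrightarrow> 0"
    "(\<lambda>k. LINT x|lebesgue_on UNIV. (norm (c *\<^sub>R (grad (\<psi> k) x - g' x)))\<^sup>2) \<longlonglongrightarrow> 0"
    using *(3,4)
    by (intro L2_tendsto_bounded_mult[where M="\<bar>c\<bar>", OF _ _ _ \<psi>(2)]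
          L2_tendsto_bounded_mult[where M="\<bar>c\<bar>", OF _ _ _ \<psi>(3)] L2_on_scaleR; simp add: abs_mult)+
  have "(\<lambda>k. LINT x|lebesgue_on UNIV. (norm ((\<phi> k x - f x) + c *\<^sub>R (\<psi> k x - f' x)))\<^sup>2) \<longlonglongrightarrow> 0"
    "(\<lambda>k. LINT x|lebesgue_on UNIV. (norm ((grad (\<phi> k) x - g x) + c *\<^sub>R (grad (\<psi> k) x - g' x)))\<^sup>2) \<longlonglongrightarrow> 0"
    using L2_tendsto_add[OF *(1) L2_on_scaleR[OF *(3)] \<phi>(2) scaled(1)]
      L2_tendsto_add[OF *(2) L2_on_scaleR[OF *(4)] \<phi>(3) scaled(2)] by auto
  then show ?thesis
    unfolding H10_grad_def
    using H1_grad_add_scale[OF open_UNIV H1] \<phi>(1) \<psi>(1)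
    by (intro conjI exI[of _ "\<lambda>k x. \<phi> k x + c * \<psi> k x"] allI test_functions_add_scale)
      (simp_all add: grad_add_scale[OF \<phi>(1) \<psi>(1)] algebra_simps)
qed

lemma H10_add_scale: "f \<in> H10 U \<Longrightarrow> f' \<in> H10 U \<Longrightarrow> (\<lambda>x. f x + c * f' x) \<in> H10 U"
  using H10_grad_add_scale unfolding mem_H10_iff by blast

lemma test_functions_subset_H10: "test_functions U \<subseteq> H10 U"
  using H10_grad_test_function mem_H10_iff by blast

text \<open>Multiplying an approximating sequence by \<open>a\<close> approximates the product. The
  target set \<open>V\<close> is separate from \<open>U\<close>: a factor vanishing near
  \<open>K\<close> carries functions from \<open>H10 \<Omega>\<close> into
  \<open>H10 (\<Omega> - K)\<close>.\<close>

lemma H10_smooth_mult: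
  assumes a: "\<And>k. Ck_on k UNIV a" "\<And>x. \<bar>a x\<bar> \<le> M" "\<And>x. norm (grad a x) \<le> M"
    and "f \<in> H10 U" and V: "\<And>\<phi>. \<phi> \<in> test_functions U \<Longrightarrow> (\<lambda>x. a x * \<phi> x) \<in> test_functions V"
  shows "(\<lambda>x. a x * f x) \<in> H10 V"
proof -
  obtain g where "H10_grad U f g" using assms(4) by (auto simp: mem_H10_iff)
  then have H1: "H1_grad UNIV f g" and L2: "L2_on UNIV f" "L2_on UNIV g"
    by (auto simp: H10_grad_def H1_grad_def)
  obtain \<phi> where \<phi>: "\<And>k::nat. \<phi> k \<in> test_functions U"
    "(\<lambda>k. LINT x|lebesgue_on UNIV. (norm (\<phi> k x - f x))\<^sup>2) \<longlonglongrightarrow> 0"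
    "(\<lambda>k. LINT x|lebesgue_on UNIV. (norm (grad (\<phi> k) x - g x))\<^sup>2) \<longlonglongrightarrow> 0"
    using \<open>H10_grad U f g\<close> by (auto simp: H10_grad_def)
  have cont: "continuous_on UNIV a" "continuous_on UNIV (grad a)"
    using smooth_continuous[OF a(1)] smooth_continuous_grad[OF a(1)] .
  have meas: "a \<in> borel_measurable (lebesgue_on UNIV)" "grad a \<in> borel_measurable (lebesgue_on UNIV)"
    using cont[THEN borel_measurable_continuous_onI] by (simp_all add: lebesgue_on_UNIV_eq measurable_completion)
  note mult = L2_on_scaleR_bounded[OF meas(1) a(2)] L2_on_scaleR_vector[OF meas(2) a(3)]
  let ?G = "\<lambda>x. a x *\<^sub>R g x + f x *\<^sub>R grad a x"
  have L2': "L2_on UNIV (\<lambda>x. a x * f x)" "L2_on UNIV ?G"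
    using mult(1)[OF L2(1)] L2_on_add[OF mult(1)[OF L2(2)] mult(2)[OF L2(1)]] by auto
  have "H1_grad UNIV (\<lambda>x. a x * f x) ?G"
    unfolding H1_grad_def
  proof (intro conjI ballI)
    fix \<psi> :: "'a \<Rightarrow> real" and b :: 'a assume \<psi>: "\<psi> \<in> test_functions UNIV" and b: "b \<in> Basis"
    have a\<psi>: "(\<lambda>x. a x * \<psi> x) \<in> test_functions UNIV"
      by (rule test_functions_smooth_mult[OF a(1) \<psi>])
    have *: "(LINT x|lebesgue_on UNIV. f x * (grad (\<lambda>x. a x * \<psi> x) x \<bullet> b)) =
        - (LINT x|lebesgue_on UNIV. (g x \<bullet> b) * (a x * \<psi> x))"
      using H1 a\<psi> b by (simp add: H1_grad_def)
    \<comment> \<open>The weak product rule results from testing the weak gradient of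
      \<open>f\<close> with \<open>a \<psi>\<close> and expanding the classical gradient of that
      test function.\<close>
    have split: "f x * (grad (\<lambda>x. a x * \<psi> x) x \<bullet> b) =
        (a x * f x) * (grad \<psi> x \<bullet> b) + ((f x *\<^sub>R grad a x) \<bullet> b) * \<psi> x" for x
      by (simp add: grad_mult[OF a(1) test_functions_Ck_on[OF \<psi>]] inner_add_left distrib_left)
    note L2\<psi> = test_functions_L2[OF \<psi> open_UNIV]
    have int: "integrable (lebesgue_on UNIV) (\<lambda>x. (a x * f x) * (grad \<psi> x \<bullet> b))"
      "integrable (lebesgue_on UNIV) (\<lambda>x. ((f x *\<^sub>R grad a x) \<bullet> b) * \<psi> x)"
      "integrable (lebesgue_on UNIV) (\<lambda>x. ((a x *\<^sub>R g x) \<bullet> b) * \<psi> x)"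
      using L2_on_mult_integrable[OF L2'(1) L2_on_component[OF L2\<psi>(2)]]
        L2_on_mult_integrable[OF L2_on_component[OF mult(2)[OF L2(1)]] L2\<psi>(1)]
        L2_on_mult_integrable[OF L2_on_component[OF mult(1)[OF L2(2)]] L2\<psi>(1)] .
    have "(LINT x|lebesgue_on UNIV. (a x * f x) * (grad \<psi> x \<bullet> b)) +
        (LINT x|lebesgue_on UNIV. ((f x *\<^sub>R grad a x) \<bullet> b) * \<psi> x) =
        - (LINT x|lebesgue_on UNIV. ((a x *\<^sub>R g x) \<bullet> b) * \<psi> x)"
      using * Bochner_Integration.integral_add[OF int(1,2)] unfolding split by (simp add: mult_ac)
    then show "(LINT x|lebesgue_on UNIV. (a x * f x) * (grad \<psi> x \<bullet> b)) =
        - (LINT x|lebesgue_on UNIV. (?G x \<bullet> b) * \<psi> x)"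
      using Bochner_Integration.integral_add[OF int(3,2)] by (simp add: inner_add_left distrib_right)
  qed (fact L2')+
  moreover have L2d: "L2_on UNIV (\<lambda>x. \<phi> k x - f x)" "L2_on UNIV (\<lambda>x. grad (\<phi> k) x - g x)" for k
    using L2 \<phi>(1) by (auto intro!: L2_on_diff intro: test_functions_L2)
  \<comment> \<open>The gradient error of the new sequence is a (grad \<phi>_k - g) + (\<phi>_k - f)
    grad a, so each piece is a bounded multiple of a quantity tending to 0 in L2.\<close>
  have lim: "(\<lambda>k. LINT x|lebesgue_on UNIV. (norm (a x * (\<phi> k x - f x)))\<^sup>2) \<longlonglongrightarrow> 0"
    "(\<lambda>k. LINT x|lebesgue_on UNIV. (norm (a x *\<^sub>R (grad (\<phi> k) x - g x)))\<^sup>2) \<longlonglongrightarrow> 0"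
    "(\<lambda>k. LINT x|lebesgue_on UNIV. (norm ((\<phi> k x - f x) *\<^sub>R grad a x))\<^sup>2) \<longlonglongrightarrow> 0"
  proof -
    have "norm (a x *\<^sub>R v) \<le> M * norm v" for x and v :: 'a
      using a(2) by (simp add: mult_right_mono)
    then show "(\<lambda>k. LINT x|lebesgue_on UNIV. (norm (a x *\<^sub>R (grad (\<phi> k) x - g x)))\<^sup>2) \<longlonglongrightarrow> 0"
      by (rule L2_tendsto_bounded_mult[where M=M, OF L2d(2) mult(1)[OF L2d(2)] _ \<phi>(3)])
    have "norm (a x * t) \<le> M * norm t" for x t
      using a(2) by (simp add: abs_mult mult_right_mono)
    then show "(\<lambda>k. LINT x|lebesgue_on UNIV. (norm (a x * (\<phi> k x - f x)))\<^sup>2) \<longlonglongrightarrow> 0"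
      using mult(1)[OF L2d(1)] by (intro L2_tendsto_bounded_mult[where M=M, OF L2d(1) _ _ \<phi>(2)]) auto
    have "norm (t *\<^sub>R grad a x) \<le> M * norm t" for x t
      using mult_left_mono[OF a(3) abs_ge_zero] by (simp add: mult.commute)
    then show "(\<lambda>k. LINT x|lebesgue_on UNIV. (norm ((\<phi> k x - f x) *\<^sub>R grad a x))\<^sup>2) \<longlonglongrightarrow> 0"
      by (rule L2_tendsto_bounded_mult[where M=M, OF L2d(1) mult(2)[OF L2d(1)] _ \<phi>(2)])
  qed
  have "(\<lambda>k. LINT x|lebesgue_on UNIV. (norm (grad (\<lambda>x. a x * \<phi> k x) x - ?G x))\<^sup>2) \<longlonglongrightarrow> 0"
    using L2_tendsto_add[OF mult(1)[OF L2d(2)] mult(2)[OF L2d(1)] lim(2,3)]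
    by (simp add: grad_mult[OF a(1) test_functions_Ck_on[OF \<phi>(1)]] algebra_simps)
  ultimately show ?thesis
    unfolding mem_H10_iff H10_grad_def using V[OF \<phi>(1)] lim(1)
    by (intro exI[of _ ?G] conjI exI[of _ "\<lambda>k x. a x * \<phi> k x"]) (auto simp: algebra_simps)
qed

section \<open>The capacity as an infimum of energies\<close>

lemma u_capacity_le:
  assumes "f \<in> H10 \<Omega>" "H1_grad \<Omega> f g" "(\<lambda>x. f x - v x) \<in> H10 (\<Omega> - K)"
  shows "u_capacity \<Omega> K v \<le> (LINT x|lebesgue_on \<Omega>. (norm (g x))\<^sup>2)"
  unfolding u_capacity_def using assms by (intro cInf_lower bdd_belowI[of _ 0]) auto

lemma zero_mem_H10: "(\<lambda>x. 0) \<in> H10 U"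
  using test_functionsI[OF Ck_on_const, of "{}" U 0] test_functions_subset_H10 by auto

text \<open>\<open>v\<close> itself is a competitor, so the set of energies is nonempty and its real
  \<open>Inf\<close> is a genuine infimum.\<close>

lemma u_capacity_ge:
  assumes "open \<Omega>" "v \<in> H10 \<Omega>"
    and "\<And>f g. f \<in> H10 \<Omega> \<Longrightarrow> H1_grad \<Omega> f g \<Longrightarrow> (\<lambda>x. f x - v x) \<in> H10 (\<Omega> - K) \<Longrightarrow>
           c \<le> (LINT x|lebesgue_on \<Omega>. (norm (g x))\<^sup>2)"
  shows "c \<le> u_capacity \<Omega> K v"
  unfolding u_capacity_def
proof (rule cInf_greatest)
  obtain g where "H1_grad \<Omega> v g"
    using assms(1,2) H1_grad_restrict by (auto simp: mem_H10_iff H10_grad_def)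
  then show "{(LINT x|lebesgue_on \<Omega>. (norm (g x))\<^sup>2) | f g.
            f \<in> H10 \<Omega> \<and> H1_grad \<Omega> f g \<and> (\<lambda>x. f x - v x) \<in> H10 (\<Omega> - K)} \<noteq> {}"
    using assms(2) zero_mem_H10 by fastforce
qed (use assms(3) in auto)

lemma u_capacity_nonneg: "open \<Omega> \<Longrightarrow> v \<in> H10 \<Omega> \<Longrightarrow> 0 \<le> u_capacity \<Omega> K v"
  by (rule u_capacity_ge) auto

lemma u_capacity_approx:
  assumes "open \<Omega>" "v \<in> H10 \<Omega>" "\<delta> > 0"
  obtains f g where "f \<in> H10 \<Omega>" "H1_grad \<Omega> f g" "(\<lambda>x. f x - v x) \<in> H10 (\<Omega> - K)"
    "(LINT x|lebesgue_on \<Omega>. (norm (g x))\<^sup>2) < u_capacity \<Omega> K v + \<delta>"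
proof (rule ccontr)
  assume "\<not> thesis"
  then have "u_capacity \<Omega> K v + \<delta> \<le> u_capacity \<Omega> K v"
    using that by (intro u_capacity_ge assms) (meson not_le)
  then show False using assms(3) by simp
qed

text \<open>The square root of the capacity is a seminorm in \<open>v\<close>; the weighted form avoids the roots.\<close>

lemma u_capacity_linear_combination_le:
  assumes \<Omega>: "open \<Omega>" and v: "v \<in> H10 \<Omega>" "w \<in> H10 \<Omega>" and t: "t > 0"
  shows "u_capacity \<Omega> K (\<lambda>x. a * v x + c * w x)
    \<le> (1 + t) * a\<^sup>2 * u_capacity \<Omega> K v + (1 + 1 / t) * c\<^sup>2 * u_capacity \<Omega> K w"
proof (rule field_le_epsilon)
  let ?I = "\<lambda>g :: 'a \<Rightarrow> 'a. LINT x|lebesgue_on \<Omega>. (norm (g x))\<^sup>2"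
  let ?A = "(1 + t) * a\<^sup>2" and ?B = "(1 + 1 / t) * c\<^sup>2"
  fix e :: real assume e: "e > 0"
  have AB: "0 \<le> ?A" "0 \<le> ?B" using t by simp_all
  \<comment> \<open>The summand 1 keeps the denominator positive even when \<open>a\<close> and
    \<open>c\<close> are both 0.\<close>
  define \<delta> where "\<delta> = e / (?A + ?B + 1)"
  have \<delta>: "\<delta> > 0" "(?A + ?B) * \<delta> \<le> e"
    using e AB by (auto simp: \<delta>_def field_simps add_nonneg_pos)
  obtain f1 g1 where 1: "f1 \<in> H10 \<Omega>" "H1_grad \<Omega> f1 g1" "(\<lambda>x. f1 x - v x) \<in> H10 (\<Omega> - K)"
    "?I g1 < u_capacity \<Omega> K v + \<delta>"
    by (rule u_capacity_approx[OF \<Omega> v(1) \<delta>(1)])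
  obtain f2 g2 where 2: "f2 \<in> H10 \<Omega>" "H1_grad \<Omega> f2 g2" "(\<lambda>x. f2 x - w x) \<in> H10 (\<Omega> - K)"
    "?I g2 < u_capacity \<Omega> K w + \<delta>"
    by (rule u_capacity_approx[OF \<Omega> v(2) \<delta>(1)])
  \<comment> \<open>The leading zero function casts a scalar multiple as an instance of
    \<open>H10_add_scale\<close>; in the next fact, \<open>a * f1\<close> is written as
    \<open>f1 + (a - 1) * f1\<close> for the same purpose.\<close>
  have f: "(\<lambda>x. 0 + a * f1 x) \<in> H10 \<Omega>" "(\<lambda>x. 0 + a * (f1 x - v x)) \<in> H10 (\<Omega> - K)"
    by (intro H10_add_scale zero_mem_H10 1)+
  have g: "H1_grad \<Omega> (\<lambda>x. f1 x + (a - 1) * f1 x) (\<lambda>x. g1 x + (a - 1) *\<^sub>R g1 x)"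
    by (intro H1_grad_add_scale 1 \<Omega>)
  have "u_capacity \<Omega> K (\<lambda>x. a * v x + c * w x) \<le> ?I (\<lambda>x. a *\<^sub>R g1 x + c *\<^sub>R g2 x)"
    using H10_add_scale[OF f(1) 2(1), of c] H10_add_scale[OF f(2) 2(3), of c]
      H1_grad_add_scale[OF \<Omega> g 2(2), of c]
    by (intro u_capacity_le[where f="\<lambda>x. a * f1 x + c * f2 x"]) (auto simp: algebra_simps)
  also have "\<dots> \<le> (1 + t) * ?I (\<lambda>x. a *\<^sub>R g1 x) + (1 + 1 / t) * ?I (\<lambda>x. c *\<^sub>R g2 x)"
    using 1(2) 2(2) t by (intro integral_norm_add_power2_le L2_on_scaleR) (auto simp: H1_grad_def)
  also have "\<dots> = ?A * ?I g1 + ?B * ?I g2"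
    by (simp add: power_mult_distrib mult.assoc)
  also have "\<dots> \<le> ?A * (u_capacity \<Omega> K v + \<delta>) + ?B * (u_capacity \<Omega> K w + \<delta>)"
    using AB 1(4) 2(4) by (intro add_mono mult_left_mono) auto
  also have "\<dots> \<le> ?A * u_capacity \<Omega> K v + ?B * u_capacity \<Omega> K w + e"
    using \<delta>(2) by (simp add: distrib_left distrib_right)
  finally show "u_capacity \<Omega> K (\<lambda>x. a * v x + c * w x)
    \<le> ?A * u_capacity \<Omega> K v + ?B * u_capacity \<Omega> K w + e" .
qed

subsection \<open>Estimates for test functions\<close>

text \<open>Integrates the divergence of the field \<open>h ((x - c) \<bullet> b) \<phi>\<^sup>2 b\<close>.\<close>

lemma weighted_L2_le_gradient:
  fixes \<phi> :: "'a::euclidean_space \<Rightarrow> real"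
  assumes \<phi>: "\<phi> \<in> test_functions U" and b: "b \<in> Basis"
    and h: "\<And>t. DERIV h t :> h' t" "continuous_on UNIV h'"
    and M: "\<And>x. x \<in> U \<Longrightarrow> \<bar>h ((x - c) \<bullet> b)\<bar> \<le> M" "0 \<le> M" and s: "s > 0"
  shows "integrable lebesgue (\<lambda>x. h' ((x - c) \<bullet> b) * (\<phi> x)\<^sup>2)"
    and "(LINT x|lebesgue. h' ((x - c) \<bullet> b) * (\<phi> x)\<^sup>2)
      \<le> M * (s * (LINT x|lebesgue. (\<phi> x)\<^sup>2) + (1 / s) * (LINT x|lebesgue. (norm (grad \<phi> x))\<^sup>2))"
proof -
  obtain C where C: "compact C" "C \<subseteq> U" "\<And>x. x \<notin> C \<Longrightarrow> \<phi> x = 0"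
    by (rule test_functions_support[OF \<phi>]) blast
  have cont: "continuous_on UNIV \<phi>" "continuous_on UNIV (grad \<phi>)" "continuous_on UNIV h"
    using smooth_continuous[OF test_functions_Ck_on[OF \<phi>]]
      smooth_continuous_grad[OF test_functions_Ck_on[OF \<phi>]] h(1)
    by (auto intro!: continuous_at_imp_continuous_on DERIV_isCont)
  let ?t = "\<lambda>x. (x - c) \<bullet> b"
  have conth: "continuous_on UNIV (\<lambda>x. h (?t x))" "continuous_on UNIV (\<lambda>x. h' (?t x))"
    by (auto intro!: continuous_on_compose2[OF cont(3)] continuous_on_compose2[OF h(2)] continuous_intros)
  have G1: "GDERIV (\<lambda>x. h (?t x)) x :> h' (?t x) *\<^sub>R b" for x
    using GDERIV_DERIV_compose[OF GDERIV_diff[OF GDERIV_inner_left[of b] GDERIV_const] h(1)]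
    by (simp add: inner_diff_left)
  \<comment> \<open>The gradient of h \<phi>^2. Its component along \<open>b\<close> is h' \<phi>^2
    plus twice h \<phi> times the partial derivative of \<phi>, so the vanishing integral trades the
    weight h' for h.\<close>
  let ?E = "\<lambda>x. h (?t x) *\<^sub>R (\<phi> x *\<^sub>R grad \<phi> x + \<phi> x *\<^sub>R grad \<phi> x) + (\<phi> x * \<phi> x) *\<^sub>R (h' (?t x) *\<^sub>R b)"
  have "(LINT x|lebesgue. ?E x \<bullet> b) = 0"
  proof (rule integral_gradient_component_0[OF C(1)])
    show "GDERIV (\<lambda>x. h (?t x) * (\<phi> x * \<phi> x)) x :> ?E x" for x
      by (intro GDERIV_mult G1 test_functions_GDERIV[OF \<phi>])
    show "continuous_on UNIV ?E"
      by (intro continuous_intros conth cont)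
  qed (use C(3) in simp)
  moreover have int: "integrable lebesgue (\<lambda>x. h' (?t x) * (\<phi> x)\<^sup>2)"
    "integrable lebesgue (\<lambda>x. h (?t x) * \<phi> x * (grad \<phi> x \<bullet> b))"
    "integrable lebesgue (\<lambda>x. ?E x \<bullet> b)"
    using C(3) by (intro integrable_compact_support(2)[OF C(1)] continuous_intros conth cont; simp)+
  moreover have "h' (?t x) * (\<phi> x)\<^sup>2 = ?E x \<bullet> b + (- 2) * (h (?t x) * \<phi> x * (grad \<phi> x \<bullet> b))" for x
    using b by (simp add: inner_add_left power2_eq_square algebra_simps)
  ultimately have eq: "(LINT x|lebesgue. h' (?t x) * (\<phi> x)\<^sup>2)
      = (LINT x|lebesgue. (- 2) * (h (?t x) * \<phi> x * (grad \<phi> x \<bullet> b)))"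
    by simp
  note int\<phi> = test_functions_integrable[OF \<phi>]
  have "(- 2) * (h (?t x) * \<phi> x * (grad \<phi> x \<bullet> b)) \<le> M * (s * (\<phi> x)\<^sup>2 + (1 / s) * (norm (grad \<phi> x))\<^sup>2)" for x
  proof (cases "x \<in> U")
    case True
    have "(- 2) * (h (?t x) * \<phi> x * (grad \<phi> x \<bullet> b)) \<le> \<bar>h (?t x)\<bar> * (2 * (\<bar>\<phi> x\<bar> * \<bar>grad \<phi> x \<bullet> b\<bar>))"
      using abs_ge_minus_self[of "h (?t x) * \<phi> x * (grad \<phi> x \<bullet> b)"]
      by (simp add: abs_mult mult_ac)
    also have "\<dots> \<le> M * (2 * (\<bar>\<phi> x\<bar> * norm (grad \<phi> x)))"
      using M True Basis_le_norm[OF b] by (intro mult_mono) auto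
    also have "\<dots> \<le> M * (s * (\<phi> x)\<^sup>2 + (1 / s) * (norm (grad \<phi> x))\<^sup>2)"
    proof (rule mult_left_mono[OF _ M(2)])
      have "0 \<le> (s * \<bar>\<phi> x\<bar> - norm (grad \<phi> x))\<^sup>2 / s"
        using s by simp
      also have "\<dots> = s * (\<phi> x)\<^sup>2 + (1 / s) * (norm (grad \<phi> x))\<^sup>2 - 2 * (\<bar>\<phi> x\<bar> * norm (grad \<phi> x))"
        using s by (simp add: power2_diff power_mult_distrib field_simps) (simp add: power2_eq_square)
      finally show "2 * (\<bar>\<phi> x\<bar> * norm (grad \<phi> x)) \<le> s * (\<phi> x)\<^sup>2 + (1 / s) * (norm (grad \<phi> x))\<^sup>2"
        by simp
    qed
    finally show ?thesis .
  next
    case False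
    then show ?thesis using M(2) s test_functions_outside[OF \<phi>] by simp
  qed
  then have "(LINT x|lebesgue. (- 2) * (h (?t x) * \<phi> x * (grad \<phi> x \<bullet> b)))
      \<le> (LINT x|lebesgue. M * (s * (\<phi> x)\<^sup>2 + (1 / s) * (norm (grad \<phi> x))\<^sup>2))"
    using int(2) int\<phi> by (intro integral_mono) auto
  then show "(LINT x|lebesgue. h' (?t x) * (\<phi> x)\<^sup>2)
      \<le> M * (s * (LINT x|lebesgue. (\<phi> x)\<^sup>2) + (1 / s) * (LINT x|lebesgue. (norm (grad \<phi> x))\<^sup>2))"
    using int\<phi> by (simp add: eq)
  show "integrable lebesgue (\<lambda>x. h' (?t x) * (\<phi> x)\<^sup>2)" by (fact int(1))
qed

text \<open>The weight h(t) = t has derivative 1 and is bounded by \<open>R\<close> on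
  \<open>U\<close>. The choice s = 1/(2R) gives the L2 term on the right the coefficient 1/2, so it
  is absorbed on the left.\<close>

lemma poincare:
  assumes \<phi>: "\<phi> \<in> test_functions U" and U: "U \<subseteq> ball c R" "R > 0"
  shows "(LINT x|lebesgue. (\<phi> x)\<^sup>2) \<le> 4 * R\<^sup>2 * (LINT x|lebesgue. (norm (grad \<phi> x))\<^sup>2)"
proof -
  obtain b :: 'a where b: "b \<in> Basis" using nonempty_Basis by blast
  have bd: "\<bar>(x - c) \<bullet> b\<bar> \<le> R" if "x \<in> U" for x
    using subsetD[OF U(1) that] Basis_le_norm[OF b, of "x - c"] by (simp add: dist_norm norm_minus_commute)
  have "(LINT x|lebesgue. 1 * (\<phi> x)\<^sup>2)
      \<le> R * ((1 / (2 * R)) * (LINT x|lebesgue. (\<phi> x)\<^sup>2) + (1 / (1 / (2 * R))) * (LINT x|lebesgue. (norm (grad \<phi> x))\<^sup>2))"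
    using U(2) bd by (intro weighted_L2_le_gradient(2)[OF \<phi> b, of "\<lambda>t. t"]) (auto intro!: derivative_eq_intros)
  then show ?thesis using U(2) by (simp add: field_simps power2_eq_square)
qed

text \<open>The weight r arctan(t/r) is bounded by 2r, while its derivative is at least 1/5 on the
  slab where the distance from the centre plane is at most 2r. This yields the factor 10 r; the
  factor 4 R^2 + 1 comes from s = 1 and the Poincare inequality.\<close>

lemma L2_small_ball_le_gradient:
  assumes \<phi>: "\<phi> \<in> test_functions U" and U: "U \<subseteq> ball c R" "R > 0" and r: "r > 0"
  shows "(LINT x|lebesgue. indicator (cball c (2 * r)) x * (\<phi> x)\<^sup>2)
    \<le> 10 * r * (4 * R\<^sup>2 + 1) * (LINT x|lebesgue. (norm (grad \<phi> x))\<^sup>2)"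
proof -
  obtain b :: 'a where b: "b \<in> Basis" using nonempty_Basis by blast
  let ?h' = "\<lambda>t::real. 1 / (1 + (t / r)\<^sup>2)"
  let ?G = "LINT x|lebesgue. (norm (grad \<phi> x))\<^sup>2"
  have h: "DERIV (\<lambda>t. r * arctan (t / r)) t :> ?h' t" for t
  proof -
    have "DERIV (\<lambda>t. r * arctan (t / r)) t :> r * (inverse (1 + (t / r)\<^sup>2) * (1 / r))"
      by (intro DERIV_cmult DERIV_chain2[OF DERIV_arctan] DERIV_cdivide DERIV_ident)
    then show ?thesis using r by (simp add: inverse_eq_divide)
  qed
  have cont: "continuous_on UNIV ?h'"
    using r by (intro continuous_intros) (auto simp: add_nonneg_eq_0_iff)
  have bd: "\<bar>r * arctan (t / r)\<bar> \<le> 2 * r" for t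
  proof -
    have "\<bar>arctan (t / r)\<bar> \<le> 2"
      using arctan_bounded[of "t / r"] pi_less_4 by linarith
    then show ?thesis using r by (simp add: abs_mult)
  qed
  note w = weighted_L2_le_gradient[OF \<phi> b h cont bd, where c = c and s = 1]
  have ind: "integrable lebesgue (\<lambda>x. indicator (cball c (2 * r)) x * (\<phi> x)\<^sup>2)"
    using integrable_mult_indicator[OF _ test_functions_integrable(1)[OF \<phi>], of "cball c (2 * r)"] by simp
  have "indicator (cball c (2 * r)) x * (\<phi> x)\<^sup>2 \<le> 5 * (?h' ((x - c) \<bullet> b) * (\<phi> x)\<^sup>2)" for x
  proof (cases "x \<in> cball c (2 * r)")
    case True
    then have "\<bar>((x - c) \<bullet> b) / r\<bar> \<le> 2"
      using r Basis_le_norm[OF b, of "x - c"] by (simp add: dist_norm norm_minus_commute field_simps)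
    then have "(((x - c) \<bullet> b) / r)\<^sup>2 \<le> 4"
      using abs_le_square_iff[of "((x - c) \<bullet> b) / r" 2] by simp
    then have "1 \<le> 5 * ?h' ((x - c) \<bullet> b)"
      by (simp add: field_simps add_pos_nonneg)
    then show ?thesis
      using mult_right_mono[of 1 "5 * ?h' ((x - c) \<bullet> b)" "(\<phi> x)\<^sup>2"] True by simp
  qed (simp add: divide_nonneg_nonneg)
  then have "(LINT x|lebesgue. indicator (cball c (2 * r)) x * (\<phi> x)\<^sup>2)
      \<le> (LINT x|lebesgue. 5 * (?h' ((x - c) \<bullet> b) * (\<phi> x)\<^sup>2))"
    using r by (intro integral_mono[OF ind] integrable_mult_right w(1)) auto
  also have "\<dots> \<le> 5 * (2 * r * ((LINT x|lebesgue. (\<phi> x)\<^sup>2) + ?G))"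
    unfolding integral_mult_right_zero using w(2) r by simp
  also have "\<dots> \<le> 5 * (2 * r * (4 * R\<^sup>2 * ?G + ?G))"
    using poincare[OF \<phi> U] r by simp
  finally show ?thesis by (simp add: algebra_simps)
qed

section \<open>Bump functions at scale \<open>r\<close>\<close>

definition ball_bump :: "'a::euclidean_space \<Rightarrow> real \<Rightarrow> real \<Rightarrow> ('a \<Rightarrow> real) \<Rightarrow> bool" where
  "ball_bump c r C \<zeta> \<longleftrightarrow> (\<forall>k. Ck_on k UNIV \<zeta>) \<and> (\<forall>x. 0 \<le> \<zeta> x \<and> \<zeta> x \<le> 1) \<and>
    (\<forall>x\<in>cball c r. \<zeta> x = 1) \<and> (\<forall>x. x \<notin> cball c (2 * r) \<longrightarrow> \<zeta> x = 0) \<and>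
    (\<forall>x. norm (grad \<zeta> x) \<le> C / r)"

text \<open>All bumps are rescalings of one profile, so a single \<open>C\<close> serves every
  radius. This uniformity matters because the growth C/r of the gradient has to be offset by the
  O(r) size of \<open>u - u c\<close>. Using the squared norm keeps the bump smooth at its
  centre.\<close>

lemma ball_bumps_exist:
  fixes c :: "'a::euclidean_space"
  obtains C where "C > 0" "\<And>r. r > 0 \<Longrightarrow> \<exists>\<zeta>. ball_bump c r C \<zeta>"
proof -
  obtain h :: "real \<Rightarrow> real" where h: "\<And>k. Ck_on k UNIV h" "\<And>t. 0 \<le> h t" "\<And>t. h t \<le> 1"
    "\<And>t. t \<le> 1 \<Longrightarrow> h t = 1" "\<And>t. t \<ge> 4 \<Longrightarrow> h t = 0"
    by (rule smooth_step_exists) blast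
  \<comment> \<open>The argument of the profile stays in [0, 4] on the ball of radius 2r, and
    outside that ball the bump vanishes, so the derivative only needs a bound on this
    interval.\<close>
  have "compact (grad h ` {0..4})"
    by (rule compact_continuous_image[OF continuous_on_subset[OF smooth_continuous_grad[OF h(1)]]]) auto
  then obtain M where M: "M > 0" "\<And>t. t \<in> {0..4} \<Longrightarrow> \<bar>grad h t\<bar> \<le> M"
    using compact_imp_bounded[of "grad h ` {0..4}"] by (auto simp: bounded_pos)
  show ?thesis
  proof (rule that[of "4 * M"])
    fix r :: real assume r: "r > 0"
    define \<zeta> where "\<zeta> x = h (inverse (r\<^sup>2) * (norm (x - c))\<^sup>2)" for x
    have q: "Ck_on k UNIV (\<lambda>x. inverse (r\<^sup>2) * (norm (x - c))\<^sup>2)" for k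
      by (intro Ck_on_mult Ck_on_const Ck_on_norm_diff_power2)
    have zero: "\<zeta> x = 0" if "x \<notin> cball c (2 * r)" for x
    proof -
      have "(2 * r)\<^sup>2 \<le> (norm (x - c))\<^sup>2"
        using that r by (intro power_mono) (auto simp: dist_norm norm_minus_commute)
      then show ?thesis
        using r unfolding \<zeta>_def by (intro h(5)) (simp add: field_simps)
    qed
    have one: "\<zeta> x = 1" if "x \<in> cball c r" for x
    proof -
      have "(norm (x - c))\<^sup>2 \<le> r\<^sup>2"
        using that r by (intro power_mono) (auto simp: dist_norm norm_minus_commute)
      then show ?thesis
        using r unfolding \<zeta>_def by (intro h(4)) (simp add: field_simps)
    qed
    have "norm (grad \<zeta> x) \<le> 4 * M / r" for x
    proof (cases "x \<in> cball c (2 * r)")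
      case True
      have "GDERIV \<zeta> x :> grad h (inverse (r\<^sup>2) * (norm (x - c))\<^sup>2) *\<^sub>R (inverse (r\<^sup>2) *\<^sub>R (2 *\<^sub>R (x - c)))"
        using GDERIV_DERIV_compose[OF GDERIV_mult[OF GDERIV_const GDERIV_norm_diff_power2]
            smooth_GDERIV[OF h(1), unfolded gderiv_deriv]]
        unfolding \<zeta>_def by simp
      then have "norm (grad \<zeta> x) = \<bar>grad h (inverse (r\<^sup>2) * (norm (x - c))\<^sup>2)\<bar> * (inverse (r\<^sup>2) * (2 * norm (x - c)))"
        by (simp add: grad_eqI abs_mult)
      also have "\<dots> \<le> M * (inverse (r\<^sup>2) * (2 * (2 * r)))"
      proof (intro mult_mono M(2))
        have n: "norm (x - c) \<le> 2 * r" using True by (simp add: dist_norm norm_minus_commute)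
        then have "(norm (x - c))\<^sup>2 \<le> (2 * r)\<^sup>2" by (intro power_mono) auto
        then show "inverse (r\<^sup>2) * (norm (x - c))\<^sup>2 \<in> {0..4}"
          using r by (simp add: field_simps)
        show "norm (x - c) \<le> 2 * r" by (fact n)
      qed (use r M(1) in auto)
      also have "\<dots> = 4 * M / r" using r by (simp add: field_simps power2_eq_square)
      finally show ?thesis .
    next
      case False
      then show ?thesis
        using grad_eqI[OF GDERIV_zero_outside[OF closed_cball zero False]] M(1) r by simp
    qed
    then show "\<exists>\<zeta>. ball_bump c r (4 * M) \<zeta>"
      using Ck_on_compose_real[OF h(1) q, folded \<zeta>_def] h(2,3) zero one
      by (intro exI[of _ \<zeta>]) (auto simp: ball_bump_def \<zeta>_def[abs_def])
  qed (use M(1) in simp)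
qed

text \<open>Weak gradients of \<open>f\<close> are not identified almost everywhere; testing both with the partial
  derivatives of \<open>\<phi>\<close> shows that \<open>g - G\<close> is orthogonal to \<open>grad \<phi>\<close>.\<close>

lemma H1_grad_energy_le:
  assumes U: "open U" and H: "H1_grad U f g" "H1_grad U f G" and \<phi>: "\<phi> \<in> test_functions U"
  shows "(LINT x|lebesgue_on U. (norm (grad \<phi> x))\<^sup>2)
    \<le> 2 * (LINT x|lebesgue_on U. (norm (g x))\<^sup>2) + 2 * (LINT x|lebesgue_on U. (norm (grad \<phi> x - G x))\<^sup>2)"
proof -
  have L2: "L2_on U g" "L2_on U G" "L2_on U (grad \<phi>)"
    using H test_functions_L2[OF \<phi> U] by (auto simp: H1_grad_def)
  have eq: "(LINT x|lebesgue_on U. (g x \<bullet> b) * (grad \<phi> x \<bullet> b)) = (LINT x|lebesgue_on U. (G x \<bullet> b) * (grad \<phi> x \<bullet> b))"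
    if "b \<in> Basis" for b
    using H test_functions_grad[OF \<phi> that] that by (auto simp: H1_grad_def)
  have inner: "(LINT x|lebesgue_on U. F x \<bullet> grad \<phi> x) =
      (\<Sum>b\<in>Basis. LINT x|lebesgue_on U. (F x \<bullet> b) * (grad \<phi> x \<bullet> b))" if "L2_on U F" for F
    unfolding euclidean_inner[of "F _" "grad \<phi> _"]
    using that L2(3) by (intro Bochner_Integration.integral_sum L2_on_mult_integrable L2_on_component)
  define a where "a x = g x - G x" for x
  have a: "L2_on U a" unfolding a_def by (intro L2_on_diff L2)
  have orth: "(LINT x|lebesgue_on U. a x \<bullet> grad \<phi> x) = 0"
    using inner[OF L2(1)] inner[OF L2(2)] eq L2
    by (simp add: a_def inner_diff_left L2_on_inner_integrable)
  \<comment> \<open>Pythagoras: by orthogonality, adding \<open>a\<close> to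
    \<open>grad \<phi>\<close> can only increase the norm, and the sum equals \<open>g\<close> plus
    the approximation error \<open>grad \<phi> - G\<close>.\<close>
  have "(LINT x|lebesgue_on U. (norm (a x + grad \<phi> x))\<^sup>2) =
      (LINT x|lebesgue_on U. (norm (a x))\<^sup>2 + 2 * (a x \<bullet> grad \<phi> x) + (norm (grad \<phi> x))\<^sup>2)"
    by (simp add: power2_norm_eq_inner inner_add inner_commute algebra_simps)
  also have "\<dots> = (LINT x|lebesgue_on U. (norm (a x))\<^sup>2) + (LINT x|lebesgue_on U. (norm (grad \<phi> x))\<^sup>2)"
    using a L2(3) L2_on_inner_integrable[OF a L2(3)] orth by (simp add: L2_on_def)
  finally have "(LINT x|lebesgue_on U. (norm (grad \<phi> x))\<^sup>2) \<le> (LINT x|lebesgue_on U. (norm (g x + (grad \<phi> x - G x)))\<^sup>2)"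
    by (simp add: a_def algebra_simps)
  also have "\<dots> \<le> (1 + 1) * (LINT x|lebesgue_on U. (norm (g x))\<^sup>2)
      + (1 + 1 / 1) * (LINT x|lebesgue_on U. (norm (grad \<phi> x - G x))\<^sup>2)"
    using L2 by (intro integral_norm_add_power2_le L2_on_diff) auto
  finally show ?thesis by simp
qed

subsection \<open>Comparison of the capacities\<close>

text \<open>The competitor \<open>\<zeta> \<phi> (u - u c)\<close> is only \<open>C\<^sup>1\<close>, and its weak gradient is given by the product rule
  because \<open>u\<close> is \<open>C\<^sup>1\<close> near its support.\<close>

lemma u_capacity_vanishing_le:
  fixes u :: "'a::euclidean_space \<Rightarrow> real"
  assumes \<Omega>: "open \<Omega>" "\<Omega> \<subseteq> ball c R" and u: "u \<in> H10 \<Omega>" "Ck_on 1 \<Omega> u"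
    and r0: "r0 > 0" "cball c r0 \<subseteq> \<Omega>"
  obtains A where "A > 0" "\<And>r K \<eta>. \<lbrakk>0 < r; 2 * r \<le> r0; K \<subseteq> ball c r; cutoff \<Omega> K \<eta>\<rbrakk> \<Longrightarrow>
    u_capacity \<Omega> K (\<lambda>x. u x - u c * \<eta> x) \<le> A * r * u_capacity \<Omega> K \<eta>"
proof -
  have "c \<in> \<Omega>" using r0 by auto
  then have R: "R > 0" using \<Omega>(2) by (auto dest: subsetD)
  \<comment> \<open>This permits replacing r^2 by r R, so that both parts of the final estimate are
    linear in \<open>r\<close>.\<close>
  have r0R: "r0 \<le> R"
  proof -
    have "cball c r0 \<subseteq> ball c R" using r0(2) \<Omega>(2) by blast
    then show ?thesis using r0(1) by (simp add: cball_subset_ball_iff)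
  qed
  obtain D where D: "\<And>x. x \<in> \<Omega> \<Longrightarrow> GDERIV u x :> D x"
    and "\<And>b. b \<in> Basis \<Longrightarrow> continuous_on \<Omega> (\<lambda>x. D x \<bullet> b)"
    using u(2) by auto
  then have contD: "continuous_on \<Omega> D"
    by (subst continuous_on_componentwise) auto
  have "bounded (D ` cball c r0)"
    using r0 by (intro compact_imp_bounded compact_continuous_image continuous_on_subset[OF contD]) auto
  then obtain L where L: "L > 0" "\<And>x. x \<in> cball c r0 \<Longrightarrow> norm (D x) \<le> L"
    by (auto simp: bounded_pos)
  have Lip: "\<bar>u x - u c\<bar> \<le> L * norm (x - c)" if "x \<in> cball c r0" for x
  proof -
    have "\<bar>h \<bullet> D z\<bar> \<le> L * norm h" if "z \<in> cball c r0" for h z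
      using Cauchy_Schwarz_ineq2[of h "D z"] mult_left_mono[OF L(2)[OF that], of "norm h"]
      by (simp add: mult.commute)
    moreover have "(u has_derivative (\<lambda>h. h \<bullet> D z)) (at z within cball c r0)" if "z \<in> cball c r0" for z
      using D[OF subsetD[OF r0(2) that]] by (auto simp: gderiv_def intro: has_derivative_at_withinI)
    ultimately have "norm (u x - u c) \<le> L * norm (x - c)"
      using that r0(1) by (intro differentiable_bound[OF convex_cball, of c r0 u "\<lambda>x h. h \<bullet> D x"] onorm_le) auto
    then show ?thesis by simp
  qed
  obtain C where C: "C > 0" "\<And>r. r > 0 \<Longrightarrow> \<exists>\<zeta>. ball_bump c r C \<zeta>"
    by (rule ball_bumps_exist[of c]) blast
  \<comment> \<open>The first summand is the coefficient of \<phi>^2 in the pointwise bound on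
    \<open>W\<close> times the constant of the small-ball estimate; the second is the coefficient of
    the squared gradient after r^2 \<le> r R. One factor \<open>r\<close> is taken out of
    each.\<close>
  define A0 where "A0 = 2 * (L * (1 + 2 * C))\<^sup>2 * (10 * (4 * R\<^sup>2 + 1)) + 8 * L\<^sup>2 * R"
  have A0: "A0 > 0"
    unfolding A0_def using L(1) C(1) R by (intro add_pos_pos mult_pos_pos zero_less_power) (auto simp: add_nonneg_pos)
  show ?thesis
  \<comment> \<open>The factor 2 is the one in \<open>H1_grad_energy_le\<close>, paid when a general
    competitor is replaced by test functions.\<close>
  proof (rule that[of "2 * A0"])
    show "2 * A0 > 0" using A0 by simp
    fix r K \<eta> assume r: "0 < r" "2 * r \<le> r0" and K: "K \<subseteq> ball c r" and cut: "cutoff \<Omega> K \<eta>"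
    obtain V where \<eta>: "\<eta> \<in> test_functions \<Omega>" and V: "open V" "K \<subseteq> V" "\<And>x. x \<in> V \<Longrightarrow> \<eta> x = 1"
      using cut by (auto simp: cutoff_def)
    obtain \<zeta> where \<zeta>: "\<And>k. Ck_on k UNIV \<zeta>" "\<And>x. 0 \<le> \<zeta> x" "\<And>x. \<zeta> x \<le> 1" "\<And>x. x \<in> cball c r \<Longrightarrow> \<zeta> x = 1"
      "\<And>x. x \<notin> cball c (2 * r) \<Longrightarrow> \<zeta> x = 0" "\<And>x. norm (grad \<zeta> x) \<le> C / r"
      using C(2)[OF r(1)] unfolding ball_bump_def by blast
    have main: "u_capacity \<Omega> K (\<lambda>x. u x - u c * \<eta> x) \<le> A0 * r * (LINT x|lebesgue. (norm (grad \<phi> x))\<^sup>2)"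
      if \<psi>: "\<psi> \<in> test_functions (\<Omega> - K)" and \<phi>_def: "\<phi> = (\<lambda>x. \<eta> x + 1 * \<psi> x)" for \<phi> \<psi>
    proof -
      have "\<psi> \<in> test_functions \<Omega>" using \<psi> test_functions_mono by blast
      then have \<phi>: "\<phi> \<in> test_functions \<Omega>"
        unfolding \<phi>_def by (intro test_functions_add_scale \<eta>)
      define m where "m = (\<lambda>x. \<zeta> x * \<phi> x)"
      have m: "m \<in> test_functions \<Omega>"
        unfolding m_def by (rule test_functions_smooth_mult[OF \<zeta>(1) \<phi>])
      obtain S where S: "compact S" "S \<subseteq> \<Omega>" "\<And>x. x \<notin> S \<Longrightarrow> m x = 0" "\<And>x. x \<notin> S \<Longrightarrow> grad m x = 0"
        by (rule test_functions_support[OF m]) blast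
      have contm: "continuous_on UNIV m" "continuous_on UNIV (grad m)"
        using smooth_continuous[OF test_functions_Ck_on[OF m]]
          smooth_continuous_grad[OF test_functions_Ck_on[OF m]] .
      obtain M1 where M1: "M1 > 0" "\<And>x. norm (m x) \<le> M1"
        by (rule continuous_compact_support_bounded[OF S(1) continuous_on_subset[OF contm(1)] S(3)]) auto
      obtain M2 where M2: "M2 > 0" "\<And>x. norm (grad m x) \<le> M2"
        by (rule continuous_compact_support_bounded[OF S(1) continuous_on_subset[OF contm(2)] S(4)]) auto

      define w where "w = (\<lambda>x. m x * (u x - u c))"
      define W where "W = (\<lambda>x. m x *\<^sub>R D x + (u x - u c) *\<^sub>R grad m x)"
      \<comment> \<open>Outside \<Omega> nothing is known about \<open>u\<close> and
        \<open>D\<close>, but there \<open>m\<close> and its gradient vanish, which makes both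
        \<open>w\<close> and \<open>W\<close> zero.\<close>
      have wW: "GDERIV w x :> W x" for x
      proof (cases "x \<in> \<Omega>")
        case True
        then show ?thesis
          unfolding w_def W_def
          using GDERIV_mult[OF test_functions_GDERIV[OF m] GDERIV_diff[OF D GDERIV_const]] by simp
      next
        case False
        then have "x \<notin> S" using S(2) by blast
        then show ?thesis
          using GDERIV_zero_outside[OF compact_imp_closed[OF S(1)], of w x] S(3,4) by (simp add: w_def W_def)
      qed
      \<comment> \<open>Continuity is glued from two open sets covering the space: \<Omega>, where
        \<open>u\<close> is C^1, and the complement of \<open>S\<close>, where \<open>W\<close>
        vanishes.\<close>
      have contW: "continuous_on UNIV W"
      proof -
        have "continuous_on \<Omega> u"
          using D by (auto intro!: continuous_at_imp_continuous_on dest: GDERIV_isCont)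
        then have "continuous_on \<Omega> W"
          unfolding W_def by (intro continuous_intros contD continuous_on_subset[OF contm(1)]
              continuous_on_subset[OF contm(2)]) auto
        moreover have "continuous_on (- S) W"
          using S(3,4) by (intro continuous_on_eq[OF continuous_on_const[of _ 0]]) (simp add: W_def)
        ultimately have "continuous_on (\<Omega> \<union> - S) W"
          using \<Omega>(1) compact_imp_closed[OF S(1)] by (intro continuous_on_open_Un) auto
        moreover have "\<Omega> \<union> - S = UNIV" using S(2) by blast
        ultimately show ?thesis by simp
      qed
      have H1w: "H1_grad \<Omega> w W"
        using S(3) by (intro H1_grad_C1_compact_support[OF \<Omega>(1) S(1,2)] wW contW) (simp add: w_def)
      have mu: "(\<lambda>x. m x * u x) \<in> H10 \<Omega>"
      proof (rule H10_smooth_mult[where M="max M1 M2"])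
        show "\<bar>m x\<bar> \<le> max M1 M2" "norm (grad m x) \<le> max M1 M2" for x
          using M1(2)[of x] M2(2)[of x] by auto
      qed (use u m test_functions_Ck_on[OF m] in \<open>auto intro: test_functions_smooth_mult\<close>)
      have wH10: "w \<in> H10 \<Omega>"
        using H10_add_scale[OF mu, of m "- u c"] m test_functions_subset_H10
        by (auto simp: w_def algebra_simps)

      obtain T where T: "compact T" "T \<subseteq> \<Omega> - K" "\<And>x. x \<notin> T \<Longrightarrow> \<psi> x = 0"
        by (rule test_functions_support[OF \<psi>]) blast
      \<comment> \<open>A neighbourhood of \<open>K\<close> on which \<eta> = 1, \<zeta> = 1 and
        \<psi> = 0, hence also \<open>m\<close> = 1.\<close>
      define N where "N = V \<inter> ball c r \<inter> - T"
      have N: "open N" "K \<subseteq> N"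
        using V T K compact_imp_closed[OF T(1)] by (auto simp: N_def)
      have mN: "m x = 1" "\<eta> x = 1" if "x \<in> N" for x
        using that V(3) T(3) \<zeta>(4) by (auto simp: N_def m_def \<phi>_def)
      \<comment> \<open>Removing the open set \<open>N\<close> from a compact set carrying
        \<open>F\<close> leaves a compact set disjoint from \<open>K\<close>.\<close>
      have away: "F \<in> test_functions (\<Omega> - K)"
        if F: "F \<in> test_functions \<Omega>" "\<And>x. x \<in> N \<Longrightarrow> F x = 0" for F
      proof -
        obtain Q where Q: "compact Q" "Q \<subseteq> \<Omega>" "\<And>x. x \<notin> Q \<Longrightarrow> F x = 0"
          by (rule test_functions_support[OF F(1)]) blast
        show ?thesis
          using Q N F(2) test_functions_Ck_on[OF F(1)]
          by (intro test_functionsI[of F "Q - N"] compact_diff) auto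
      qed
      \<comment> \<open>Admissibility rests on the identity w - (u - u(c) \<eta>) = (m - 1) u + u(c)
        (\<eta> - m): both \<open>m - 1\<close> and \<open>\<eta> - m\<close> vanish on
        \<open>N\<close>.\<close>
      have m1: "Ck_on k UNIV (\<lambda>x. m x + (-1))" for k
        by (intro Ck_on_add Ck_on_const test_functions_Ck_on[OF m])
      have gm1: "grad (\<lambda>x. m x + (-1)) x = grad m x" for x
        by (rule grad_eqI, rule GDERIV_subst[OF GDERIV_add[OF test_functions_GDERIV[OF m] GDERIV_const]]) simp
      have "(\<lambda>x. (m x + (-1)) * u x) \<in> H10 (\<Omega> - K)"
      proof (rule H10_smooth_mult[where M="max (M1 + 1) M2", OF m1 _ _ u(1)])
        show "\<bar>m x + (-1)\<bar> \<le> max (M1 + 1) M2" "norm (grad (\<lambda>x. m x + (-1)) x) \<le> max (M1 + 1) M2" for x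
          using M1(2)[of x] M2(2)[of x] gm1 by (auto simp: le_max_iff_disj)
        show "(\<lambda>x. (m x + (-1)) * F x) \<in> test_functions (\<Omega> - K)" if "F \<in> test_functions \<Omega>" for F
          using mN by (intro away test_functions_smooth_mult[OF m1 that]) auto
      qed
      moreover have "(\<lambda>x. \<eta> x + (-1) * m x) \<in> H10 (\<Omega> - K)"
        using mN by (intro subsetD[OF test_functions_subset_H10] away test_functions_add_scale \<eta> m) auto
      ultimately have "(\<lambda>x. (m x + (-1)) * u x + u c * (\<eta> x + (-1) * m x)) \<in> H10 (\<Omega> - K)"
        by (rule H10_add_scale)
      then have adm: "(\<lambda>x. w x - (u x - u c * \<eta> x)) \<in> H10 (\<Omega> - K)"
        by (simp add: w_def algebra_simps)

      let ?B = "cball c (2 * r)" and ?G = "LINT x|lebesgue. (norm (grad \<phi> x))\<^sup>2"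
      \<comment> \<open>On the ball, \<open>u - u c\<close> is at most 2 r L and the gradient of
        \<open>m\<close> at most |grad \<phi>| + |\<phi>| C/r, so the powers of \<open>r\<close>
        cancel in the \<phi> term and one remains on the gradient term. Squaring the sum costs a
        factor 2.\<close>
      have bound: "(norm (W x))\<^sup>2 \<le> 2 * (L * (1 + 2 * C))\<^sup>2 * (indicator ?B x * (\<phi> x)\<^sup>2)
          + 8 * r\<^sup>2 * L\<^sup>2 * (norm (grad \<phi> x))\<^sup>2" for x
      proof (cases "x \<in> ?B")
        case True
        then have x: "x \<in> cball c r0" "norm (x - c) \<le> 2 * r"
          using r by (auto simp: dist_norm norm_minus_commute)
        have ux: "\<bar>u x - u c\<bar> \<le> L * (2 * r)"
          using Lip[OF x(1)] mult_left_mono[OF x(2), of L] L(1) by linarith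
        have gm: "grad m x = \<zeta> x *\<^sub>R grad \<phi> x + \<phi> x *\<^sub>R grad \<zeta> x"
          unfolding m_def by (rule grad_mult[OF \<zeta>(1) test_functions_Ck_on[OF \<phi>]])
        have "norm (m x *\<^sub>R D x) \<le> \<bar>\<phi> x\<bar> * L"
          using L(2)[OF x(1)] \<zeta>(2,3)[of x] mult_mono[of "\<zeta> x * \<bar>\<phi> x\<bar>" "\<bar>\<phi> x\<bar>" "norm (D x)" L]
            mult_right_mono[of "\<zeta> x" 1 "\<bar>\<phi> x\<bar>"]
          by (simp add: m_def abs_mult)
        moreover have "norm ((u x - u c) *\<^sub>R grad m x) \<le> (L * (2 * r)) * (norm (grad \<phi> x) + \<bar>\<phi> x\<bar> * (C / r))"
        proof -
          have "norm (grad m x) \<le> \<bar>\<zeta> x\<bar> * norm (grad \<phi> x) + \<bar>\<phi> x\<bar> * norm (grad \<zeta> x)"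
            unfolding gm by (rule order_trans[OF norm_triangle_ineq]) simp
          also have "\<dots> \<le> 1 * norm (grad \<phi> x) + \<bar>\<phi> x\<bar> * (C / r)"
            using \<zeta>(2,3,6)[of x] by (intro add_mono mult_mono) auto
          finally show ?thesis
            using ux r L(1) by (simp add: mult_mono)
        qed
        ultimately have "norm (W x) \<le> \<bar>\<phi> x\<bar> * L + (L * (2 * r)) * (norm (grad \<phi> x) + \<bar>\<phi> x\<bar> * (C / r))"
          unfolding W_def by (rule order_trans[OF norm_triangle_ineq add_mono])
        also have "\<dots> = L * (1 + 2 * C) * \<bar>\<phi> x\<bar> + 2 * r * L * norm (grad \<phi> x)"
          using r(1) by (simp add: field_simps)
        finally have "(norm (W x))\<^sup>2 \<le> (L * (1 + 2 * C) * \<bar>\<phi> x\<bar> + 2 * r * L * norm (grad \<phi> x))\<^sup>2"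
          by (rule power_mono) simp
        also have "\<dots> \<le> 2 * (L * (1 + 2 * C) * \<bar>\<phi> x\<bar>)\<^sup>2 + 2 * (2 * r * L * norm (grad \<phi> x))\<^sup>2"
          using norm_add_power2_le_weighted[of 1 "L * (1 + 2 * C) * \<bar>\<phi> x\<bar>" "2 * r * L * norm (grad \<phi> x)"] by simp
        finally show ?thesis
          using True by (simp add: power_mult_distrib)
      next
        case False
        have "m y = 0" if "y \<notin> ?B" for y using \<zeta>(5)[OF that] by (simp add: m_def)
        then have "grad m x = 0" "m x = 0"
          using grad_eqI[OF GDERIV_zero_outside[OF closed_cball _ False]] False by blast+
        then show ?thesis by (simp add: W_def)
      qed
      have int: "integrable lebesgue (\<lambda>x. (norm (W x))\<^sup>2)"
        using S(3,4) contW by (intro integrable_compact_support(2)[OF S(1)] continuous_intros) (simp_all add: W_def)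
      have indint: "integrable lebesgue (\<lambda>x. indicator ?B x * (\<phi> x)\<^sup>2)"
        using integrable_mult_indicator[OF _ test_functions_integrable(1)[OF \<phi>], of ?B] by simp
      have "u_capacity \<Omega> K (\<lambda>x. u x - u c * \<eta> x) \<le> (LINT x|lebesgue_on \<Omega>. (norm (W x))\<^sup>2)"
        by (rule u_capacity_le[OF wH10 H1w adm])
      also have "\<dots> = (LINT x|lebesgue. (norm (W x))\<^sup>2)"
        using test_functions_outside[OF m] by (intro integral_lebesgue_on_support \<Omega>(1)) (simp add: W_def)
      also have "\<dots> \<le> (LINT x|lebesgue. 2 * (L * (1 + 2 * C))\<^sup>2 * (indicator ?B x * (\<phi> x)\<^sup>2)
          + 8 * r\<^sup>2 * L\<^sup>2 * (norm (grad \<phi> x))\<^sup>2)"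
        using test_functions_integrable(2)[OF \<phi>] indint by (intro integral_mono[OF int] bound) auto
      also have "\<dots> = 2 * (L * (1 + 2 * C))\<^sup>2 * (LINT x|lebesgue. indicator ?B x * (\<phi> x)\<^sup>2) + 8 * r\<^sup>2 * L\<^sup>2 * ?G"
        using test_functions_integrable(2)[OF \<phi>] indint by simp
      also have "\<dots> \<le> 2 * (L * (1 + 2 * C))\<^sup>2 * (10 * r * (4 * R\<^sup>2 + 1) * ?G) + 8 * (r * R) * L\<^sup>2 * ?G"
      proof (intro add_mono mult_left_mono mult_right_mono)
        show "r\<^sup>2 \<le> r * R" using r r0R by (simp add: power2_eq_square)
      qed (use L2_small_ball_le_gradient[OF \<phi> \<Omega>(2) R r(1)] in auto)
      also have "\<dots> = A0 * r * ?G"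
        by (simp add: A0_def algebra_simps)
      finally show ?thesis .
    qed
    show "u_capacity \<Omega> K (\<lambda>x. u x - u c * \<eta> x) \<le> 2 * A0 * r * u_capacity \<Omega> K \<eta>" (is "?cap \<le> _")
    proof -
      \<comment> \<open>In this form the claim is a lower bound for an infimum, so it suffices to
        treat an arbitrary competitor \<open>f\<close> for \<eta>, approximated by the test
        functions \<eta> + \<psi>_k.\<close>
      have "?cap / (2 * A0 * r) \<le> u_capacity \<Omega> K \<eta>"
      proof (rule u_capacity_ge[OF \<Omega>(1) subsetD[OF test_functions_subset_H10 \<eta>]])
        fix f g assume f: "f \<in> H10 \<Omega>" "H1_grad \<Omega> f g" "(\<lambda>x. f x - \<eta> x) \<in> H10 (\<Omega> - K)"
        then obtain G' where "H10_grad (\<Omega> - K) (\<lambda>x. f x - \<eta> x) G'"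
          by (auto simp: mem_H10_iff)
        then obtain \<psi> where H1: "H1_grad UNIV (\<lambda>x. f x - \<eta> x) G'"
          and \<psi>: "\<And>k::nat. \<psi> k \<in> test_functions (\<Omega> - K)"
            "(\<lambda>k. LINT x|lebesgue_on UNIV. (norm (grad (\<psi> k) x - G' x))\<^sup>2) \<longlonglongrightarrow> 0"
          by (auto simp: H10_grad_def)
        define I where "I = (LINT x|lebesgue_on \<Omega>. (norm (g x))\<^sup>2)"
        define J where "J k = (LINT x|lebesgue_on UNIV. (norm (grad (\<psi> k) x - G' x))\<^sup>2)" for k
        \<comment> \<open>A second weak gradient of \<open>f\<close> besides \<open>g\<close>,
          namely the one to which the gradients of the approximating test functions
          converge.\<close>
        have HG: "H1_grad \<Omega> f (\<lambda>x. grad \<eta> x + 1 *\<^sub>R G' x)"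
          using H1_grad_add_scale[OF \<Omega>(1) H1_grad_test_function[OF \<eta> \<Omega>(1)] H1_grad_restrict[OF \<Omega>(1) H1], of 1]
          by simp
        have "?cap \<le> A0 * r * (2 * I + 2 * J k)" for k
        proof -
          let ?\<phi> = "\<lambda>x. \<eta> x + 1 * \<psi> k x"
          have "\<psi> k \<in> test_functions \<Omega>" using \<psi>(1) test_functions_mono by blast
          then have \<phi>: "?\<phi> \<in> test_functions \<Omega>"
            by (intro test_functions_add_scale \<eta>)
          have g\<phi>: "grad ?\<phi> x = grad \<eta> x + 1 *\<^sub>R grad (\<psi> k) x" for x
            by (rule grad_add_scale[OF \<eta> \<psi>(1)])
          have L2: "L2_on UNIV (\<lambda>x. grad (\<psi> k) x - G' x)"
            using H1 test_functions_L2(2)[OF \<psi>(1) open_UNIV] by (intro L2_on_diff) (auto simp: H1_grad_def)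
          have "(LINT x|lebesgue. (norm (grad ?\<phi> x))\<^sup>2) = (LINT x|lebesgue_on \<Omega>. (norm (grad ?\<phi> x))\<^sup>2)"
            using test_functions_outside(2)[OF \<phi>] by (intro integral_lebesgue_on_support[symmetric] \<Omega>(1)) simp
          also have "\<dots> \<le> 2 * I + 2 * (LINT x|lebesgue_on \<Omega>. (norm (grad (\<psi> k) x - G' x))\<^sup>2)"
            using H1_grad_energy_le[OF \<Omega>(1) f(2) HG \<phi>] unfolding g\<phi> I_def by simp
          also have "\<dots> \<le> 2 * I + 2 * J k"
            using L2_on_restrict(2)[OF \<Omega>(1) L2] by (simp add: J_def lebesgue_on_UNIV_eq)
          finally have "A0 * r * (LINT x|lebesgue. (norm (grad ?\<phi> x))\<^sup>2) \<le> A0 * r * (2 * I + 2 * J k)"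
            using A0 r(1) by (intro mult_left_mono) auto
          with main[OF \<psi>(1)[of k] refl] show ?thesis by (rule order_trans)
        qed
        \<comment> \<open>Only the right-hand side depends on \<open>k\<close>, and its error
          \<open>J k\<close> tends to 0.\<close>
        moreover have "(\<lambda>k. A0 * r * (2 * I + 2 * J k)) \<longlonglongrightarrow> A0 * r * (2 * I + 2 * 0)"
          using \<psi>(2) unfolding J_def by (intro tendsto_intros)
        ultimately have "?cap \<le> A0 * r * (2 * I + 2 * 0)"
          by (intro tendsto_lowerbound[of _ _ sequentially ?cap]) auto
        then show "?cap / (2 * A0 * r) \<le> (LINT x|lebesgue_on \<Omega>. (norm (g x))\<^sup>2)"
          using A0 r(1) by (simp add: I_def field_simps)
      qed
      then show ?thesis using A0 r(1) by (simp add: field_simps)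
    qed
  qed
qed

section \<open>The asymptotic formula\<close>

lemma cutoff_ball_exists:
  assumes "r > 0" "cball c (2 * r) \<subseteq> \<Omega>" "K \<subseteq> ball c r"
  shows "\<exists>\<eta>. cutoff \<Omega> K \<eta>"
proof -
  obtain C where "\<And>r. r > 0 \<Longrightarrow> \<exists>\<zeta>. ball_bump c r C \<zeta>"
    by (rule ball_bumps_exist[of c]) blast
  from this[OF assms(1)] obtain \<zeta> where \<zeta>: "\<And>k. Ck_on k UNIV \<zeta>" "\<And>x. x \<in> cball c r \<Longrightarrow> \<zeta> x = 1"
    "\<And>x. x \<notin> cball c (2 * r) \<Longrightarrow> \<zeta> x = 0"
    unfolding ball_bump_def by blast
  have "\<zeta> \<in> test_functions \<Omega>"
    using assms(2) by (intro test_functionsI[of _ "cball c (2 * r)"] \<zeta>) auto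
  then show ?thesis
    using assms(3) \<zeta>(2) by (auto simp: cutoff_def intro!: exI[of _ \<zeta>] exI[of _ "ball c r"])
qed

theorem proposition1p5:
  fixes \<Omega> :: "(real ^ 'n) set" and u :: "real ^ 'n \<Rightarrow> real"
    and K :: "real \<Rightarrow> (real ^ 'n) set" and x0 :: "real ^ 'n"
  assumes "CARD('n) \<ge> 2"
    and "bounded \<Omega>" "connected \<Omega>" "open \<Omega>"
    and "u \<in> H10 \<Omega>" "Ck_on 2 \<Omega> u"
    and "\<And>\<epsilon>. \<epsilon> > 0 \<Longrightarrow> compact (K \<epsilon>) \<and> K \<epsilon> \<subseteq> \<Omega>"
    and "x0 \<in> \<Omega>" "concentrating_to \<Omega> K {x0}" "u x0 \<noteq> 0"
  shows "(\<lambda>\<epsilon>. u_capacity \<Omega> (K \<epsilon>) u - (u x0)\<^sup>2 * condenser_capacity \<Omega> (K \<epsilon>))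
           \<in> o[at_right 0](\<lambda>\<epsilon>. condenser_capacity \<Omega> (K \<epsilon>))"
proof (rule landau_o.smallI)
  fix e :: real assume e: "e > 0"
  obtain R where R: "\<Omega> \<subseteq> ball x0 R"
    using bounded_subset_ballD[OF assms(2)] by blast
  obtain r0 where r0: "r0 > 0" "cball x0 r0 \<subseteq> \<Omega>"
    using assms(4,8) open_contains_cball by blast
  have "Ck_on 1 \<Omega> u"
    using Ck_on_SucD[of 1 \<Omega> u] assms(6) by (simp add: numeral_2_eq_2)
  then obtain A where A: "A > 0" "\<And>r K \<eta>. \<lbrakk>0 < r; 2 * r \<le> r0; K \<subseteq> ball x0 r; cutoff \<Omega> K \<eta>\<rbrakk> \<Longrightarrow>
    u_capacity \<Omega> K (\<lambda>x. u x - u x0 * \<eta> x) \<le> A * r * u_capacity \<Omega> K \<eta>"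
    by (rule u_capacity_vanishing_le[OF assms(4) R assms(5) _ r0]) blast
  define U where "U = (u x0)\<^sup>2"
  have U: "U > 0" using assms(10) by (simp add: U_def)
  \<comment> \<open>Small enough that replacing \<open>U\<close> by \<open>(1 + t) * U\<close> costs
    at most e/4; the weight \<open>t\<close> is fixed before the radius.\<close>
  define t where "t = min 1 (e / (4 * U))"
  have t: "0 < t" "t \<le> 1" "t * U \<le> e / 4"
    using e U by (auto simp: t_def min_def field_simps)
  \<comment> \<open>The relative size demanded of the capacity of \<open>w\<close>: after the large
    factor \<open>1 + 1 / t\<close> it contributes exactly e/4. The radius \<open>r\<close> is then
    chosen so that \<open>A * r \<le> s\<close>.\<close>
  define s where "s = e / (4 * (1 + 1 / t))"
  have s: "0 < s" "(1 + 1 / t) * s = e / 4"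
  proof -
    have p: "1 + 1 / t > 0" using t(1) by (simp add: add_pos_pos)
    then show "0 < s" using e by (simp add: s_def)
    show "(1 + 1 / t) * s = e / 4"
      unfolding s_def using p by (metis less_irrefl mult.commute nonzero_mult_divide_mult_cancel_left
          times_divide_eq_right)
  qed
  define r where "r = min (r0 / 2) (s / A)"
  have r: "0 < r" "2 * r \<le> r0" "A * r \<le> s"
    using r0(1) s(1) A(1) by (auto simp: r_def min_def field_simps)
  have "ball x0 r \<subseteq> \<Omega>" using r r0(2) by (auto simp: subset_iff)
  then obtain \<epsilon>U where \<epsilon>U: "\<epsilon>U > 0" "\<And>\<epsilon>. 0 < \<epsilon> \<Longrightarrow> \<epsilon> < \<epsilon>U \<Longrightarrow> K \<epsilon> \<subseteq> ball x0 r"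
    using assms(9) r(1) unfolding concentrating_to_def by (metis open_ball centre_in_ball empty_subsetI insert_subset)
  have "norm (u_capacity \<Omega> (K \<epsilon>) u - U * condenser_capacity \<Omega> (K \<epsilon>)) \<le> e * norm (condenser_capacity \<Omega> (K \<epsilon>))"
    if \<epsilon>: "0 < \<epsilon>" "\<epsilon> < \<epsilon>U" for \<epsilon>
  proof -
    note K = \<epsilon>U(2)[OF \<epsilon>]
    define \<eta> where "\<eta> = (SOME \<eta>. cutoff \<Omega> (K \<epsilon>) \<eta>)"
    \<comment> \<open>A cutoff exists because \<open>K \<epsilon>\<close> lies in a small ball, so
      the choice operator in \<open>condenser_capacity\<close> does select one.\<close>
    have cut: "cutoff \<Omega> (K \<epsilon>) \<eta>"
      unfolding \<eta>_def using r r0(2) K by (intro someI_ex[OF cutoff_ball_exists[of r x0]]) auto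
    then have \<eta>: "\<eta> \<in> H10 \<Omega>"
      using test_functions_subset_H10 by (auto simp: cutoff_def)
    define w where "w = (\<lambda>x. u x - u x0 * \<eta> x)"
    have w: "w \<in> H10 \<Omega>"
      using H10_add_scale[OF assms(5) \<eta>, of "- u x0"] by (simp add: w_def)
    let ?cap = "u_capacity \<Omega> (K \<epsilon>)"
    define c where "c = ?cap \<eta>"
    have c: "condenser_capacity \<Omega> (K \<epsilon>) = c" "0 \<le> c"
      using u_capacity_nonneg[OF assms(4) \<eta>] by (simp_all add: condenser_capacity_def c_def \<eta>_def)
    have "?cap w \<le> s * c"
      using A(2)[OF r(1,2) K cut] mult_right_mono[OF r(3) c(2)] by (simp add: w_def c_def)
    then have cw: "(1 + 1 / t) * ?cap w \<le> e / 4 * c"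
      using mult_left_mono[of "?cap w" "s * c" "1 + 1 / t"] t(1) s(2) by (simp flip: mult.assoc)
    \<comment> \<open>Upper bound: \<open>u\<close> is \<open>u x0 * \<eta>\<close> perturbed by
      \<open>w\<close>, whose capacity is small relative to \<open>c\<close>.\<close>
    have "?cap (\<lambda>x. u x0 * \<eta> x + 1 * w x) \<le> (1 + t) * (u x0)\<^sup>2 * c + (1 + 1 / t) * 1\<^sup>2 * ?cap w"
      unfolding c_def by (rule u_capacity_linear_combination_le[OF assms(4) \<eta> w t(1)])
    then have "?cap u \<le> (1 + t) * (U * c) + (1 + 1 / t) * ?cap w"
      by (simp add: w_def U_def mult.assoc)
    then have upper: "?cap u \<le> (1 + t) * (U * c) + e / 4 * c"
      using cw by linarith
    \<comment> \<open>Lower bound: the roles are exchanged by writing \<eta> as (u - w) / u(x0),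
      which is where u(x0) \<noteq> 0 enters. Multiplying by \<open>U\<close> then clears the
      inverse squares.\<close>
    have "?cap (\<lambda>x. inverse (u x0) * u x + (- inverse (u x0)) * w x)
        \<le> (1 + t) * (inverse (u x0))\<^sup>2 * ?cap u + (1 + 1 / t) * (- inverse (u x0))\<^sup>2 * ?cap w"
      by (rule u_capacity_linear_combination_le[OF assms(4,5) w t(1)])
    moreover have "(\<lambda>x. inverse (u x0) * u x + (- inverse (u x0)) * w x) = \<eta>"
      using assms(10) by (auto simp: w_def field_simps)
    ultimately have "U * c \<le> U * ((1 + t) * (inverse (u x0))\<^sup>2 * ?cap u + (1 + 1 / t) * (- inverse (u x0))\<^sup>2 * ?cap w)"
      using U by (simp add: c_def)
    also have "\<dots> = (1 + t) * ?cap u + (1 + 1 / t) * ?cap w"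
      using assms(10) by (simp add: U_def field_simps)
    finally have "U * c \<le> ?cap u + t * ?cap u + e / 4 * c"
      using cw by (simp add: algebra_simps)
    \<comment> \<open>The excess t Cap(u) is controlled by the upper bound just obtained: it is at
      most 3e/4 times \<open>c\<close>, which together with the contribution e/4 of \<open>w\<close>
      makes exactly \<open>e * c\<close>.\<close>
    moreover have "t * ?cap u \<le> e / 2 * c + e / 4 * c"
    proof -
      have "t * ?cap u \<le> t * ((1 + t) * (U * c)) + t * (e / 4 * c)"
        using mult_left_mono[OF upper less_imp_le[OF t(1)]] by (simp add: distrib_left)
      moreover have "t * (e / 4 * c) \<le> 1 * (e / 4 * c)"
        using t e c(2) by (intro mult_right_mono) auto
      moreover have "(t * U) * ((1 + t) * c) \<le> (e / 4) * (2 * c)"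
        using t U e c(2) by (intro mult_mono) auto
      ultimately show ?thesis by (simp add: algebra_simps)
    qed
    moreover have "?cap u \<le> U * c + e / 4 * c + e / 4 * c"
      using upper mult_right_mono[OF t(3) c(2)] by (simp add: algebra_simps)
    moreover have "0 \<le> e * c" using e c(2) by simp
    ultimately have "\<bar>?cap u - U * c\<bar> \<le> e * c" by (simp add: abs_le_iff mult.commute[of c e])
    then show ?thesis using c by simp
  qed
  then show "\<forall>\<^sub>F \<epsilon> in at_right 0. norm (u_capacity \<Omega> (K \<epsilon>) u - (u x0)\<^sup>2 * condenser_capacity \<Omega> (K \<epsilon>))
      \<le> e * norm (condenser_capacity \<Omega> (K \<epsilon>))"
    using \<epsilon>U(1) unfolding U_def eventually_at_right_field by blast
qed

end
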